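(* Let $n\ge 2$ and let $G_n$ be the subgroup of $S_n$ generated by the $n$-cycle $(1,n,n-1,\dots,2)$. There is a Bieberbach subgroup $\widetilde{G_n}$ of $VB_n/\Gamma_2(VP_n)$ of dimension $n(n-1)$ whose holonomy group is $G_n$. Further, the center $Z(\widetilde{G_n})$ is a free Abelian group of rank $n-1$.
   Context: A group $\Pi$ is crystallographic of dimension $m$ with holonomy group $\Phi$ if there is a short exact sequence $0\to\mathbb{Z}^m\to\Pi\to\Phi\to1$ with $\Phi$ finite such that the representation $\Phi\to\mathrm{Aut}(\mathbb{Z}^m)$ induced by conjugation is faithful. A Bieberbach group is a torsion-free crystallographic group. $\Gamma_2(H)=[H,H]$. $VB_n$ is the group with generators $\sigma_i,\rho_i$ ($1\le i\le n-1$) and relations: $\sigma_i\sigma_{i+1}\sigma_i=\sigma_{i+1}\sigma_i\sigma_{i+1}$, $\rho_i\rho_{i+1}\rho_i=\rho_{i+1}\rho_i\rho_{i+1}$, $\rho_i\rho_{i+1}\sigma_i=\sigma_{i+1}\rho_i\rho_{i+1}$ for $1\le i\le n-2$; $\rho_i^2=1$; and $\sigma_i\sigma_j=\sigma_j\sigma_i$, $\rho_i\rho_j=\rho_j\rho_i$, $\sigma_i\rho_j=\rho_j\sigma_i$ for $|i-j|\ge 2$. $VP_n$ is the kernel of the homomorphism $VB_n\to S_n$, $\sigma_i,\rho_i\mapsto(i,i+1)$. *)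

theory Defs
  imports "HOL-Algebra.Algebra"
begin

section \<open>Groups given by generators and relations\<close>

text \<open>The letter \<open>(x, True)\<close> stands for \<open>x\<close> and \<open>(x, False)\<close> for its inverse;
  a relation \<open>l = r\<close> between words is the pair \<open>(l, r)\<close>.\<close>

type_synonym 'a word = "('a \<times> bool) list"

abbreviation words :: "'a set \<Rightarrow> 'a word set"
  where "words S \<equiv> lists (S \<times> UNIV)"

inductive pres_eq :: "'a set \<Rightarrow> ('a word \<times> 'a word) set \<Rightarrow> 'a word \<Rightarrow> 'a word \<Rightarrow> bool"
  for S :: "'a set" and R :: "('a word \<times> 'a word) set" where
  refl: "w \<in> words S \<Longrightarrow> pres_eq S R w w"
| sym: "pres_eq S R v w \<Longrightarrow> pres_eq S R w v"
| trans: "pres_eq S R u v \<Longrightarrow> pres_eq S R v w \<Longrightarrow> pres_eq S R u w"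
| cancel: "u \<in> words S \<Longrightarrow> v \<in> words S \<Longrightarrow> x \<in> S
    \<Longrightarrow> pres_eq S R (u @ [(x, b), (x, \<not> b)] @ v) (u @ v)"
| rel: "u \<in> words S \<Longrightarrow> v \<in> words S \<Longrightarrow> l \<in> words S \<Longrightarrow> r \<in> words S \<Longrightarrow> (l, r) \<in> R
    \<Longrightarrow> pres_eq S R (u @ l @ v) (u @ r @ v)"

definition pres_class :: "'a set \<Rightarrow> ('a word \<times> 'a word) set \<Rightarrow> 'a word \<Rightarrow> 'a word set"
  where "pres_class S R w = {w'. pres_eq S R w w'}"

definition presented_group :: "'a set \<Rightarrow> ('a word \<times> 'a word) set \<Rightarrow> 'a word set monoid"
  where "presented_group S R =
    \<lparr>carrier = pres_class S R ` words S,
     monoid.mult = (\<lambda>A B. \<Union>a\<in>A. \<Union>b\<in>B. pres_class S R (a @ b)),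
     one = pres_class S R []\<rparr>"

primrec word_eval :: "('b, 'c) monoid_scheme \<Rightarrow> ('a \<Rightarrow> 'b) \<Rightarrow> 'a word \<Rightarrow> 'b" where
  "word_eval G f [] = \<one>\<^bsub>G\<^esub>"
| "word_eval G f (a # w) =
     (if snd a then f (fst a) else inv\<^bsub>G\<^esub> f (fst a)) \<otimes>\<^bsub>G\<^esub> word_eval G f w"

text \<open>The map out of a presented group determined by the images \<open>f x\<close> of the generators; it is
  well defined when \<open>f\<close> respects the relations, since \<open>word_eval G f\<close> is then constant on every
  class (see \<open>pres_hom_class\<close>).\<close>

definition pres_hom :: "('b, 'c) monoid_scheme \<Rightarrow> ('a \<Rightarrow> 'b) \<Rightarrow> 'a word set \<Rightarrow> 'b"
  where "pres_hom G f A = the_elem (word_eval G f ` A)"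

lemma pres_eq_words: "pres_eq S R v w \<Longrightarrow> v \<in> words S \<and> w \<in> words S"
  by (induction rule: pres_eq.induct) auto

lemma pres_eq_append_left:
  assumes "pres_eq S R v w" "u \<in> words S"
  shows "pres_eq S R (u @ v) (u @ w)"
  using assms
proof (induction rule: pres_eq.induct)
  case (cancel p q x b)
  then show ?case using pres_eq.cancel[of "u @ p" S q x R b] by simp
next
  case (rel p q l r)
  then show ?case using pres_eq.rel[of "u @ p" S q l r R] by simp
next
  case (refl w)
  then show ?case by (intro pres_eq.refl) auto
next
  case (sym v w)
  then show ?case by (simp add: pres_eq.sym)
next
  case (trans p q r)
  then show ?case using pres_eq.trans by metis
qed

lemma pres_eq_append_right:
  assumes "pres_eq S R v w" "u \<in> words S"
  shows "pres_eq S R (v @ u) (w @ u)"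
  using assms
proof (induction rule: pres_eq.induct)
  case (cancel p q x b)
  then show ?case using pres_eq.cancel[of p S "q @ u" x R b] by simp
next
  case (rel p q l r)
  then show ?case using pres_eq.rel[of p S "q @ u" l r R] by simp
next
  case (refl w)
  then show ?case by (intro pres_eq.refl) auto
next
  case (sym v w)
  then show ?case by (simp add: pres_eq.sym)
next
  case (trans p q r)
  then show ?case using pres_eq.trans by metis
qed

lemma pres_eq_append:
  assumes "pres_eq S R v w" "pres_eq S R v' w'"
  shows "pres_eq S R (v @ v') (w @ w')"
  using pres_eq_append_right[OF assms(1), of v'] pres_eq_append_left[OF assms(2), of w]
    pres_eq_words[OF assms(1)] pres_eq_words[OF assms(2)] pres_eq.trans by blast

lemma pres_class_eq_iff:
  assumes "v \<in> words S" "w \<in> words S"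
  shows "pres_class S R v = pres_class S R w \<longleftrightarrow> pres_eq S R v w"
proof
  assume "pres_class S R v = pres_class S R w"
  then show "pres_eq S R v w"
    using pres_eq.refl[OF assms(2), of R] by (auto simp: pres_class_def)
next
  assume *: "pres_eq S R v w"
  have "pres_eq S R v u \<longleftrightarrow> pres_eq S R w u" for u
    using pres_eq.trans[OF *] pres_eq.trans[OF pres_eq.sym[OF *]] by blast
  then show "pres_class S R v = pres_class S R w" by (simp add: pres_class_def)
qed

lemma pres_class_mult:
  assumes "v \<in> words S" "w \<in> words S"
  shows "pres_class S R v \<otimes>\<^bsub>presented_group S R\<^esub> pres_class S R w = pres_class S R (v @ w)"
proof -
  have 1: "pres_class S R (a @ b) = pres_class S R (v @ w)"
    if "a \<in> pres_class S R v" "b \<in> pres_class S R w" for a b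
  proof -
    have *: "pres_eq S R (v @ w) (a @ b)"
      using that by (simp add: pres_class_def pres_eq_append)
    then show ?thesis
      using pres_class_eq_iff[of "v @ w" S "a @ b" R] pres_eq_words[OF *] by simp
  qed
  have 2: "v \<in> pres_class S R v" "w \<in> pres_class S R w"
    using assms by (simp_all add: pres_class_def pres_eq.refl)
  have "(\<Union>a\<in>pres_class S R v. \<Union>b\<in>pres_class S R w. pres_class S R (a @ b))
      = (\<Union>a\<in>pres_class S R v. \<Union>b\<in>pres_class S R w. pres_class S R (v @ w))"
    by (intro SUP_cong HOL.refl 1)
  also have "\<dots> = pres_class S R (v @ w)"
    using 2 by blast
  finally show ?thesis by (simp add: presented_group_def)
qed

lemma pres_eq_inverse:
  "w \<in> words S \<Longrightarrow> pres_eq S R (map (apsnd Not) (rev w) @ w) []"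
proof (induction w)
  case Nil
  then show ?case by (auto intro: pres_eq.refl)
next
  case (Cons a w)
  obtain x b where a: "a = (x, b)" by force
  have w: "w \<in> words S" "x \<in> S" using Cons.prems a by auto
  have "map (apsnd Not) (rev w) \<in> words S" using w(1) by (induction w) auto
  then have "pres_eq S R (map (apsnd Not) (rev w) @ [(x, \<not> b), (x, \<not> \<not> b)] @ w)
      (map (apsnd Not) (rev w) @ w)"
    using w by (intro pres_eq.cancel)
  then show ?case using pres_eq.trans[OF _ Cons.IH[OF w(1)]] a by simp
qed

lemma group_presented_group: "group (presented_group S R)"
proof (rule groupI)
  fix x y assume "x \<in> carrier (presented_group S R)" "y \<in> carrier (presented_group S R)"
  then obtain v w where *: "v \<in> words S" "w \<in> words S" "x = pres_class S R v" "y = pres_class S R w"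
    by (auto simp: presented_group_def)
  then have "v @ w \<in> words S" by simp
  then show "x \<otimes>\<^bsub>presented_group S R\<^esub> y \<in> carrier (presented_group S R)"
    unfolding *(3,4) pres_class_mult[OF *(1,2)] by (auto simp: presented_group_def)
next
  show "\<one>\<^bsub>presented_group S R\<^esub> \<in> carrier (presented_group S R)"
    by (auto simp: presented_group_def)
next
  fix x y z
  assume "x \<in> carrier (presented_group S R)" "y \<in> carrier (presented_group S R)"
    "z \<in> carrier (presented_group S R)"
  then obtain u v w where *: "u \<in> words S" "v \<in> words S" "w \<in> words S"
    "x = pres_class S R u" "y = pres_class S R v" "z = pres_class S R w"
    by (auto simp: presented_group_def)
  have "u @ v \<in> words S" "v @ w \<in> words S" using * by simp_all
  with * show "x \<otimes>\<^bsub>presented_group S R\<^esub> y \<otimes>\<^bsub>presented_group S R\<^esub> z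
      = x \<otimes>\<^bsub>presented_group S R\<^esub> (y \<otimes>\<^bsub>presented_group S R\<^esub> z)"
    by (simp only: pres_class_mult append_assoc)
next
  fix x assume "x \<in> carrier (presented_group S R)"
  then obtain w where *: "w \<in> words S" "x = pres_class S R w"
    by (auto simp: presented_group_def)
  have one: "\<one>\<^bsub>presented_group S R\<^esub> = pres_class S R []" by (simp add: presented_group_def)
  show "\<one>\<^bsub>presented_group S R\<^esub> \<otimes>\<^bsub>presented_group S R\<^esub> x = x"
    using pres_class_mult[of "[]" S w R] * one by simp
  let ?v = "map (apsnd Not) (rev w)"
  have v: "?v \<in> words S" using *(1) by (induction w) auto
  have "pres_class S R ?v \<otimes>\<^bsub>presented_group S R\<^esub> x = \<one>\<^bsub>presented_group S R\<^esub>"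
    unfolding *(2) pres_class_mult[OF v *(1)] one
    using pres_eq_inverse[OF *(1), of R] pres_class_eq_iff[of "?v @ w" S "[]" R] v *(1) by simp
  then show "\<exists>y\<in>carrier (presented_group S R).
      y \<otimes>\<^bsub>presented_group S R\<^esub> x = \<one>\<^bsub>presented_group S R\<^esub>"
    using v by (auto simp: presented_group_def)
qed

lemma (in group) word_eval_closed:
  assumes "f \<in> S \<rightarrow> carrier G" "w \<in> words S"
  shows "word_eval G f w \<in> carrier G"
  using assms(2)
proof (induction w)
  case (Cons a w)
  then have "f (fst a) \<in> carrier G"
    using assms(1) by (cases a) auto
  with Cons show ?case by simp
qed simp

lemma (in group) word_eval_append:
  assumes "f \<in> S \<rightarrow> carrier G" "v \<in> words S" "w \<in> words S"
  shows "word_eval G f (v @ w) = word_eval G f v \<otimes> word_eval G f w"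
  using assms(2)
proof (induction v)
  case Nil
  then show ?case using word_eval_closed[OF assms(1,3)] by simp
next
  case (Cons a v)
  then have "f (fst a) \<in> carrier G" "v \<in> words S"
    using assms(1) by (cases a, auto)+
  then show ?case
    using Cons.IH word_eval_closed[OF assms(1)] assms(3) by (auto simp: m_assoc)
qed

lemma (in group) word_eval_cong:
  assumes f: "f \<in> S \<rightarrow> carrier G"
    and R: "\<And>l r. (l, r) \<in> R \<Longrightarrow> word_eval G f l = word_eval G f r"
    and "pres_eq S R v w"
  shows "word_eval G f v = word_eval G f w"
  using assms(3)
proof (induction rule: pres_eq.induct)
  case (cancel u v x b)
  have x: "f x \<in> carrier G" using cancel f by auto
  have "word_eval G f (u @ [(x, b), (x, \<not> b)] @ v)
      = word_eval G f u \<otimes> (word_eval G f [(x, b), (x, \<not> b)] \<otimes> word_eval G f v)"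
    using cancel word_eval_append[OF f] by (simp del: word_eval.simps append_Cons)
  also have "word_eval G f [(x, b), (x, \<not> b)] = \<one>"
    using x by simp
  finally show ?case
    using cancel word_eval_append[OF f] word_eval_closed[OF f] by simp
next
  case (rel u v l r)
  then show ?case using word_eval_append[OF f] R by simp
qed simp_all

lemma (in group) pres_hom_class:
  assumes "f \<in> S \<rightarrow> carrier G"
    and "\<And>l r. (l, r) \<in> R \<Longrightarrow> word_eval G f l = word_eval G f r"
    and "w \<in> words S"
  shows "pres_hom G f (pres_class S R w) = word_eval G f w"
proof -
  have "word_eval G f ` pres_class S R w = {word_eval G f w}"
    using word_eval_cong[OF assms(1,2)] pres_eq.refl[OF assms(3)]
    unfolding pres_class_def by force
  then show ?thesis by (simp add: pres_hom_def)
qed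

lemma (in group) pres_hom_hom:
  assumes f: "f \<in> S \<rightarrow> carrier G"
    and R: "\<And>l r. (l, r) \<in> R \<Longrightarrow> word_eval G f l = word_eval G f r"
  shows "pres_hom G f \<in> hom (presented_group S R) G"
proof (rule homI)
  fix x assume "x \<in> carrier (presented_group S R)"
  then obtain v where *: "v \<in> words S" "x = pres_class S R v"
    by (auto simp: presented_group_def)
  then show "pres_hom G f x \<in> carrier G"
    using pres_hom_class[OF f R] word_eval_closed[OF f] by simp
next
  fix x y assume "x \<in> carrier (presented_group S R)" "y \<in> carrier (presented_group S R)"
  then obtain v w where *: "v \<in> words S" "w \<in> words S" "x = pres_class S R v" "y = pres_class S R w"
    by (auto simp: presented_group_def)
  then have "v @ w \<in> words S" by simp
  then show "pres_hom G f (x \<otimes>\<^bsub>presented_group S R\<^esub> y) = pres_hom G f x \<otimes> pres_hom G f y"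
    using * pres_hom_class[OF f R] pres_class_mult[OF *(1,2)] word_eval_append[OF f *(1,2)] by simp
qed


section \<open>Virtual braid groups\<close>

datatype vb_gen = Sig nat | Rho nat

abbreviation sg :: "nat \<Rightarrow> vb_gen \<times> bool" where "sg i \<equiv> (Sig i, True)"
abbreviation rh :: "nat \<Rightarrow> vb_gen \<times> bool" where "rh i \<equiv> (Rho i, True)"

definition vb_gens :: "nat \<Rightarrow> vb_gen set"
  where "vb_gens n = Sig ` {1..n-1} \<union> Rho ` {1..n-1}"

definition vb_rels :: "nat \<Rightarrow> (vb_gen word \<times> vb_gen word) set" where
  "vb_rels n =
     {([sg i, sg (i+1), sg i], [sg (i+1), sg i, sg (i+1)]) | i. i \<in> {1..n-2}}
   \<union> {([rh i, rh (i+1), rh i], [rh (i+1), rh i, rh (i+1)]) | i. i \<in> {1..n-2}}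
   \<union> {([rh i, rh (i+1), sg i], [sg (i+1), rh i, rh (i+1)]) | i. i \<in> {1..n-2}}
   \<union> {([rh i, rh i], []) | i. i \<in> {1..n-1}}
   \<union> {([sg i, sg j], [sg j, sg i]) | i j. i \<in> {1..n-1} \<and> j \<in> {1..n-1} \<and> \<bar>int i - int j\<bar> \<ge> 2}
   \<union> {([rh i, rh j], [rh j, rh i]) | i j. i \<in> {1..n-1} \<and> j \<in> {1..n-1} \<and> \<bar>int i - int j\<bar> \<ge> 2}
   \<union> {([sg i, rh j], [rh j, sg i]) | i j. i \<in> {1..n-1} \<and> j \<in> {1..n-1} \<and> \<bar>int i - int j\<bar> \<ge> 2}"

definition VB :: "nat \<Rightarrow> vb_gen word set monoid"
  where "VB n = presented_group (vb_gens n) (vb_rels n)"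

primrec vb_gen_perm :: "vb_gen \<Rightarrow> nat \<Rightarrow> nat" where
  "vb_gen_perm (Sig i) = transpose i (i + 1)"
| "vb_gen_perm (Rho i) = transpose i (i + 1)"

definition vb_perm :: "nat \<Rightarrow> vb_gen word set \<Rightarrow> nat \<Rightarrow> nat"
  where "vb_perm n = pres_hom (sym_group n) vb_gen_perm"

definition VP :: "nat \<Rightarrow> vb_gen word set set"
  where "VP n = kernel (VB n) (sym_group n) (vb_perm n)"

definition VB_mod_Gamma2_VP :: "nat \<Rightarrow> vb_gen word set set monoid"
  where "VB_mod_Gamma2_VP n = VB n Mod derived (VB n) (VP n)"

lemma group_VB: "group (VB n)"
  by (simp add: VB_def group_presented_group)

lemma transpose_braid:
  "transpose i (i+1) \<circ> transpose (i+1) (i+2) \<circ> transpose i (i+1)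
   = transpose (i+1) (i+2) \<circ> transpose i (i+1) \<circ> transpose (i+1) (i+2 :: nat)"
  by (auto simp: fun_eq_iff transpose_def)

lemma transpose_far:
  assumes "\<bar>int i - int j\<bar> \<ge> 2"
  shows "transpose i (i+1) \<circ> transpose j (j+1) = transpose j (j+1) \<circ> transpose i (i+1)"
  using assms by (auto simp: fun_eq_iff transpose_def)

lemma vb_gen_perm_closed: "vb_gen_perm \<in> vb_gens n \<rightarrow> carrier (sym_group n)"
  by (auto simp: vb_gens_def sym_group_def intro!: permutes_swap_id)

lemma vb_gen_perm_rels:
  "(l, r) \<in> vb_rels n \<Longrightarrow>
     word_eval (sym_group n) vb_gen_perm l = word_eval (sym_group n) vb_gen_perm r"
  using transpose_braid transpose_far
  by (auto simp: vb_rels_def sym_group_def comp_assoc)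

lemma vb_perm_hom: "vb_perm n \<in> hom (VB n) (sym_group n)"
  unfolding vb_perm_def VB_def
  by (rule group.pres_hom_hom[OF sym_group_is_group vb_gen_perm_closed vb_gen_perm_rels])

lemma vb_perm_gen:
  assumes "x \<in> vb_gens n"
  shows "vb_perm n (pres_class (vb_gens n) (vb_rels n) [(x, True)]) = vb_gen_perm x"
proof -
  have "word_eval (sym_group n) vb_gen_perm [(x, True)] = vb_gen_perm x"
    by (simp add: sym_group_def)
  then show ?thesis
    unfolding vb_perm_def using assms
    by (subst group.pres_hom_class[OF sym_group_is_group vb_gen_perm_closed vb_gen_perm_rels]) auto
qed

lemma group_VB_mod_Gamma2_VP: "group (VB_mod_Gamma2_VP n)"
proof -
  interpret group_hom "VB n" "sym_group n" "vb_perm n"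
    by (simp add: group_hom_def group_hom_axioms_def group_VB sym_group_is_group vb_perm_hom)
  have "VP n \<lhd> VB n" by (simp add: VP_def normal_kernel)
  then have "derived (VB n) (VP n) \<lhd> VB n" by (rule group.derived_is_normal[OF group_VB])
  then show ?thesis unfolding VB_mod_Gamma2_VP_def by (rule normal.factorgroup_is_group)
qed


section \<open>Crystallographic and Bieberbach groups\<close>

text \<open>The short exact sequence is \<open>\<int>\<^sup>m \<rightarrow> G \<rightarrow> \<Phi>\<close> with maps \<open>\<iota>\<close> and \<open>p\<close>; \<open>\<theta>\<close> is the induced
  representation of \<open>\<Phi>\<close>, determined by \<open>\<iota> (\<theta> (p g) v) = g \<cdot> \<iota> v \<cdot> g\<^sup>-\<^sup>1\<close>.\<close>

definition crystallographic ::
    "('a, 'c) monoid_scheme \<Rightarrow> nat \<Rightarrow> ('b, 'd) monoid_scheme \<Rightarrow> bool" where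
  "crystallographic G m \<Phi> \<longleftrightarrow>
     group G \<and> group \<Phi> \<and> finite (carrier \<Phi>) \<and>
     (\<exists>\<iota> p \<theta>.
        \<iota> \<in> mon (free_Abelian_group {..<m}) G \<and>
        p \<in> epi G \<Phi> \<and>
        \<iota> ` carrier (free_Abelian_group {..<m}) = kernel G \<Phi> p \<and>
        \<theta> \<in> mon \<Phi> (AutoGroup (free_Abelian_group {..<m})) \<and>
        (\<forall>g \<in> carrier G. \<forall>v \<in> carrier (free_Abelian_group {..<m}).
           \<iota> (\<theta> (p g) v) = g \<otimes>\<^bsub>G\<^esub> \<iota> v \<otimes>\<^bsub>G\<^esub> inv\<^bsub>G\<^esub> g))"

definition torsion_free :: "('a, 'c) monoid_scheme \<Rightarrow> bool"
  where "torsion_free G \<longleftrightarrow>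
    (\<forall>x \<in> carrier G. \<forall>k::nat. k > 0 \<longrightarrow> x [^]\<^bsub>G\<^esub> k = \<one>\<^bsub>G\<^esub> \<longrightarrow> x = \<one>\<^bsub>G\<^esub>)"

definition bieberbach ::
    "('a, 'c) monoid_scheme \<Rightarrow> nat \<Rightarrow> ('b, 'd) monoid_scheme \<Rightarrow> bool"
  where "bieberbach G m \<Phi> \<longleftrightarrow> crystallographic G m \<Phi> \<and> torsion_free G"

definition center :: "('a, 'c) monoid_scheme \<Rightarrow> 'a set"
  where "center G = {z \<in> carrier G. \<forall>x \<in> carrier G. z \<otimes>\<^bsub>G\<^esub> x = x \<otimes>\<^bsub>G\<^esub> z}"

text \<open>\<open>cycle_of_list\<close> sends each entry of the list to the next one, so this is
  the cycle \<open>1 \<mapsto> n \<mapsto> n - 1 \<mapsto> \<dots> \<mapsto> 2 \<mapsto> 1\<close>.\<close>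

definition n_cycle :: "nat \<Rightarrow> nat \<Rightarrow> nat"
  where "n_cycle n = cycle_of_list (1 # rev [2..<n+1])"

definition cyc_group :: "nat \<Rightarrow> (nat \<Rightarrow> nat) monoid"
  where "cyc_group n = (sym_group n)\<lparr>carrier := generate (sym_group n) {n_cycle n}\<rparr>"

end

theory Submission
  imports Defs
begin

text \<open>
  Abelianizing the pure subgroup turns the virtual braid group into an explicit semidirect product.
  Let \<open>\<int>\<^sup>P\<close> be the free abelian group on the set \<open>P\<close> of ordered pairs of distinct elements of
  \<open>{1, \<dots>, n}\<close>, permuted by the symmetric group. Then \<open>VB\<^sub>n / \<Gamma>\<^sub>2(VP\<^sub>n)\<close> is isomorphic to the semidirect
  product of \<open>\<int>\<^sup>P\<close> with the symmetric group, where \<open>\<rho>\<^sub>i\<close> becomes the transposition \<open>(i, i + 1)\<close> and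
  \<open>\<sigma>\<^sub>i\<close> becomes the basis vector at \<open>(i, i + 1)\<close> followed by the same transposition
  (\<open>VB_mod_Gamma2_VP_iso_pair_group\<close>). The map exists because the relations hold in the semidirect
  product (\<open>vb_gen_pair_rels\<close>) and the lattice is abelian. It is bijective for two reasons. The
  \<open>\<rho>\<^sub>i\<close> satisfy the Coxeter relations and hence generate a faithful copy of the symmetric group, in
  which the stabilizer of the last point is generated by all \<open>\<rho>\<^sub>i\<close> but the last (\<open>R_stabilizer\<close>).
  Consequently the conjugates of \<open>\<sigma>\<^sub>n\<^sub>-\<^sub>1 \<rho>\<^sub>n\<^sub>-\<^sub>1\<close> by this copy are indexed by \<open>P\<close>, and together with the
  \<open>\<rho>\<^sub>i\<close> they generate the quotient; as they map to the basis of \<open>\<int>\<^sup>P\<close>, there is no room for a kernel.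

  In the semidirect product let \<open>c\<close> be the \<open>n\<close>-cycle and let \<open>|v|\<close> be the sum of the coordinates of
  \<open>v\<close>, which is invariant under permutations. The Bieberbach group is
  \<open>{(v, c\<^sup>|\<^sup>v\<^sup>|) | v \<in> \<int>\<^sup>P}\<close>, called \<open>twisted n\<close> below. It surjects onto the cyclic group generated by \<open>c\<close>,
  with kernel the sublattice of full rank \<open>n (n - 1)\<close> given by \<open>n dvd |v|\<close>, and the action on this
  kernel is faithful. If \<open>(v, c\<^sup>|\<^sup>v\<^sup>|)\<close> has finite order, then \<open>|v| = 0\<close>, so the permutation is trivial
  and \<open>v = 0\<close>. The center consists of the \<open>c\<close>-invariant vectors; since \<open>c\<close> has exactly \<open>n - 1\<close> orbits
  on \<open>P\<close>, one for each nonzero residue of \<open>j - i\<close> modulo \<open>n\<close>, and each orbit has \<open>n\<close> elements, these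
  vectors automatically satisfy \<open>n dvd |v|\<close> and form a free abelian group of rank \<open>n - 1\<close>.
\<close>

section \<open>A criterion for crystallographic groups\<close>

lemma (in group) inv_mult_cancel:
  assumes "x \<in> carrier G" "y \<in> carrier G"
  shows "inv x \<otimes> (x \<otimes> y) = y" "x \<otimes> (inv x \<otimes> y) = y"
  using assms by (simp_all add: m_assoc[symmetric])

text \<open>The induced representation never has to be given: conjugation by \<open>g\<close> preserves the kernel of
  \<open>p\<close>, and since that kernel is abelian, elements with the same image under \<open>p\<close> conjugate it in
  the same way. So conjugation factors through \<open>p\<close>. Faithfulness becomes the condition that only
  elements of the kernel centralize the kernel.\<close>

lemma crystallographicI:
  fixes G :: "('a, 'c) monoid_scheme" and \<Phi> :: "('b, 'd) monoid_scheme"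
  assumes G: "group G" and \<Phi>: "group \<Phi>" "finite (carrier \<Phi>)"
    and \<iota>: "\<iota> \<in> mon (free_Abelian_group {..<m}) G"
    and p: "p \<in> epi G \<Phi>"
    and img: "\<iota> ` carrier (free_Abelian_group {..<m}) = kernel G \<Phi> p"
    and faithful: "\<And>g. g \<in> carrier G \<Longrightarrow>
      (\<And>x. x \<in> kernel G \<Phi> p \<Longrightarrow> g \<otimes>\<^bsub>G\<^esub> x = x \<otimes>\<^bsub>G\<^esub> g) \<Longrightarrow> g \<in> kernel G \<Phi> p"
  shows "crystallographic G m \<Phi>"
proof -
  interpret G: group G by fact
  interpret \<Phi>: group \<Phi> by fact
  let ?Z = "free_Abelian_group {..<m}"
  interpret Z: comm_group ?Z by (rule abelian_free_Abelian_group)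
  interpret p: group_hom G \<Phi> p
    using p by (simp add: group_hom_def group_hom_axioms_def epi_def G \<Phi>)
  interpret \<iota>: group_hom ?Z G \<iota>
    using \<iota> by (simp add: group_hom_def group_hom_axioms_def mon_def G)
  have inj: "inj_on \<iota> (carrier ?Z)" using \<iota> by (simp add: mon_def)
  interpret K: normal "kernel G \<Phi> p" G by (rule p.normal_kernel)
  define c where "c g = (\<lambda>v\<in>carrier ?Z. inv_into (carrier ?Z) \<iota> (g \<otimes>\<^bsub>G\<^esub> \<iota> v \<otimes>\<^bsub>G\<^esub> inv\<^bsub>G\<^esub> g))" for g
  have c: "c g v \<in> carrier ?Z" "\<iota> (c g v) = g \<otimes>\<^bsub>G\<^esub> \<iota> v \<otimes>\<^bsub>G\<^esub> inv\<^bsub>G\<^esub> g"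
    if "g \<in> carrier G" "v \<in> carrier ?Z" for g v
  proof -
    have "\<iota> v \<in> kernel G \<Phi> p" using that img by blast
    then have *: "g \<otimes>\<^bsub>G\<^esub> \<iota> v \<otimes>\<^bsub>G\<^esub> inv\<^bsub>G\<^esub> g \<in> \<iota> ` carrier ?Z"
      unfolding img using K.inv_op_closed2 that by blast
    then show "c g v \<in> carrier ?Z" "\<iota> (c g v) = g \<otimes>\<^bsub>G\<^esub> \<iota> v \<otimes>\<^bsub>G\<^esub> inv\<^bsub>G\<^esub> g"
      using that(2) inv_into_into[OF *] f_inv_into_f[OF *] by (simp_all add: c_def)
  qed
  have c_eqI: "c g v = u" if "g \<in> carrier G" "v \<in> carrier ?Z" "u \<in> carrier ?Z"
    "\<iota> u = g \<otimes>\<^bsub>G\<^esub> \<iota> v \<otimes>\<^bsub>G\<^esub> inv\<^bsub>G\<^esub> g" for g v u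
    using inj_onD[OF inj, of "c g v" u] c[OF that(1,2)] that by simp
  have c_mult: "c (g \<otimes>\<^bsub>G\<^esub> h) v = c g (c h v)"
    if "g \<in> carrier G" "h \<in> carrier G" "v \<in> carrier ?Z" for g h v
  proof (rule c_eqI)
    have "\<iota> v \<in> carrier G" using \<iota>.hom_closed that(3) by blast
    then show "\<iota> (c g (c h v)) = g \<otimes>\<^bsub>G\<^esub> h \<otimes>\<^bsub>G\<^esub> \<iota> v \<otimes>\<^bsub>G\<^esub> inv\<^bsub>G\<^esub> (g \<otimes>\<^bsub>G\<^esub> h)"
      using that c by (simp add: G.m_assoc G.inv_mult_group del: carrier_free_Abelian_group_iff)
  qed (use that c in blast)+
  \<comment> \<open>This is where commutativity of the lattice enters; it makes \<open>c\<close> depend on \<open>p g\<close> only.\<close>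
  have c_kernel: "c k v = v" if k: "k \<in> kernel G \<Phi> p" and v: "v \<in> carrier ?Z" for k v
  proof -
    obtain u where u: "u \<in> carrier ?Z" "k = \<iota> u" using k img by blast
    have closed: "\<iota> v \<in> carrier G" "k \<in> carrier G"
      using \<iota>.hom_closed v u by blast+
    have "k \<otimes>\<^bsub>G\<^esub> \<iota> v = \<iota> (u \<otimes>\<^bsub>?Z\<^esub> v)"
      unfolding u(2) by (rule \<iota>.hom_mult[OF u(1) v, symmetric])
    also have "\<dots> = \<iota> (v \<otimes>\<^bsub>?Z\<^esub> u)"
      by (simp only: Z.m_comm[OF u(1) v])
    also have "\<dots> = \<iota> v \<otimes>\<^bsub>G\<^esub> k"
      unfolding u(2) by (rule \<iota>.hom_mult[OF v u(1)])
    finally have "\<iota> v = k \<otimes>\<^bsub>G\<^esub> \<iota> v \<otimes>\<^bsub>G\<^esub> inv\<^bsub>G\<^esub> k"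
      using closed G.inv_solve_right by (metis G.m_closed)
    then show ?thesis by (rule c_eqI[OF closed(2) v v])
  qed
  have c_bij: "bij_betw (c g) (carrier ?Z) (carrier ?Z)" if g: "g \<in> carrier G" for g
  proof (rule bij_betw_byWitness[where f' = "c (inv\<^bsub>G\<^esub> g)"])
    have one: "c \<one>\<^bsub>G\<^esub> v = v" if "v \<in> carrier ?Z" for v
      using that c_kernel[OF K.one_closed] by blast
    show "\<forall>v\<in>carrier ?Z. c (inv\<^bsub>G\<^esub> g) (c g v) = v"
      using one g c_mult[of "inv\<^bsub>G\<^esub> g" g] by (metis G.inv_closed G.l_inv)
    show "\<forall>v\<in>carrier ?Z. c g (c (inv\<^bsub>G\<^esub> g) v) = v"
      using one g c_mult[of g "inv\<^bsub>G\<^esub> g"] by (metis G.inv_closed G.r_inv)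
  qed (use c g in blast)+
  have c_auto: "c g \<in> auto ?Z" if g: "g \<in> carrier G" for g
  proof -
    have "c g \<in> hom ?Z ?Z"
    proof (rule homI)
      fix u v assume uv: "u \<in> carrier ?Z" "v \<in> carrier ?Z"
      then have *: "\<iota> u \<in> carrier G" "\<iota> v \<in> carrier G" using \<iota>.hom_closed by blast+
      show "c g (u \<otimes>\<^bsub>?Z\<^esub> v) = c g u \<otimes>\<^bsub>?Z\<^esub> c g v"
      proof (rule c_eqI)
        show "\<iota> (c g u \<otimes>\<^bsub>?Z\<^esub> c g v) = g \<otimes>\<^bsub>G\<^esub> \<iota> (u \<otimes>\<^bsub>?Z\<^esub> v) \<otimes>\<^bsub>G\<^esub> inv\<^bsub>G\<^esub> g"
          using uv g * c[OF g] \<iota>.hom_mult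
          by (simp add: G.m_assoc G.inv_mult_cancel del: mult_free_Abelian_group carrier_free_Abelian_group_iff)
      qed (use g uv c Z.m_closed in blast)+
    qed (use c g in blast)
    moreover have "c g \<in> Bij (carrier ?Z)"
      using c_bij[OF g] by (simp add: Bij_def c_def)
    ultimately show ?thesis by (simp add: auto_def)
  qed
  have c_cong: "c g = c h" if gh: "g \<in> carrier G" "h \<in> carrier G" "p g = p h" for g h
  proof
    fix v
    show "c g v = c h v"
    proof (cases "v \<in> carrier ?Z")
      case True
      let ?k = "inv\<^bsub>G\<^esub> h \<otimes>\<^bsub>G\<^esub> g"
      have cl: "?k \<in> carrier G" using gh by blast
      have "p ?k = inv\<^bsub>\<Phi>\<^esub> p h \<otimes>\<^bsub>\<Phi>\<^esub> p h"
        using p.hom_mult[OF G.inv_closed[OF gh(2)] gh(1)] p.hom_inv[OF gh(2)] gh(3) by metis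
      then have k: "?k \<in> kernel G \<Phi> p"
        using cl \<Phi>.l_inv[OF p.hom_closed[OF gh(2)]] unfolding kernel_def by (metis (mono_tags, lifting) mem_Collect_eq)
      have "c g v = c (h \<otimes>\<^bsub>G\<^esub> ?k) v"
        by (simp only: G.inv_mult_cancel(2)[OF gh(2,1)])
      also have "\<dots> = c h v"
        by (simp only: c_mult[OF gh(2) cl True] c_kernel[OF k True])
      finally show ?thesis .
    next
      case False
      then show ?thesis by (simp only: c_def restrict_apply if_False)
    qed
  qed
  then obtain \<theta> where \<theta>: "\<And>g. g \<in> carrier G \<Longrightarrow> c g = \<theta> (p g)"
    using function_factors_left_gen[of "\<lambda>x. x \<in> carrier G" p c] by blast
  have surj: "\<exists>g\<in>carrier G. x = p g" if "x \<in> carrier \<Phi>" for x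
    using that p by (auto simp: epi_def)
  have "\<theta> \<in> mon \<Phi> (AutoGroup ?Z)"
    unfolding mon_def
  proof (intro CollectI conjI homI inj_onI)
    fix x assume "x \<in> carrier \<Phi>"
    then show "\<theta> x \<in> carrier (AutoGroup ?Z)"
      using surj \<theta> c_auto by (force simp: AutoGroup_def)
  next
    fix x y assume "x \<in> carrier \<Phi>" "y \<in> carrier \<Phi>"
    then obtain g h where gh: "g \<in> carrier G" "h \<in> carrier G" "x = p g" "y = p h"
      using surj by metis
    have B: "c g \<in> Bij (carrier ?Z)" "c h \<in> Bij (carrier ?Z)"
      using c_auto gh by (auto simp: auto_def)
    have "\<theta> (x \<otimes>\<^bsub>\<Phi>\<^esub> y) = c (g \<otimes>\<^bsub>G\<^esub> h)" using gh \<theta> by simp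
    also have "\<dots> = compose (carrier ?Z) (c g) (c h)"
    proof
      fix v
      show "c (g \<otimes>\<^bsub>G\<^esub> h) v = compose (carrier ?Z) (c g) (c h) v"
        using c_mult[OF gh(1,2), of v]
        by (cases "v \<in> carrier ?Z") (simp_all only: compose_def restrict_apply c_def if_True if_False)
    qed
    also have "\<dots> = \<theta> x \<otimes>\<^bsub>AutoGroup ?Z\<^esub> \<theta> y"
      using gh \<theta> B by (simp add: AutoGroup_def BijGroup_def)
    finally show "\<theta> (x \<otimes>\<^bsub>\<Phi>\<^esub> y) = \<theta> x \<otimes>\<^bsub>AutoGroup ?Z\<^esub> \<theta> y" .
  next
    fix x y assume xy: "x \<in> carrier \<Phi>" "y \<in> carrier \<Phi>" "\<theta> x = \<theta> y"
    then obtain g h where gh: "g \<in> carrier G" "h \<in> carrier G" "x = p g" "y = p h"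
      using surj by metis
    have eq: "c g = c h" using gh xy \<theta> by simp
    let ?k = "inv\<^bsub>G\<^esub> h \<otimes>\<^bsub>G\<^esub> g"
    have "?k \<in> kernel G \<Phi> p"
    proof (rule faithful)
      fix z assume "z \<in> kernel G \<Phi> p"
      then obtain v where v: "v \<in> carrier ?Z" "z = \<iota> v" using img by blast
      have z: "z \<in> carrier G" using v \<iota>.hom_closed by blast
      have "g \<otimes>\<^bsub>G\<^esub> z \<otimes>\<^bsub>G\<^esub> inv\<^bsub>G\<^esub> g = h \<otimes>\<^bsub>G\<^esub> z \<otimes>\<^bsub>G\<^esub> inv\<^bsub>G\<^esub> h"
        using c(2)[OF gh(1) v(1)] c(2)[OF gh(2) v(1)] eq v by simp
      then have "g \<otimes>\<^bsub>G\<^esub> z = h \<otimes>\<^bsub>G\<^esub> z \<otimes>\<^bsub>G\<^esub> inv\<^bsub>G\<^esub> h \<otimes>\<^bsub>G\<^esub> g"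
        using gh z by (metis G.inv_solve_right G.m_closed G.inv_closed)
      then show "?k \<otimes>\<^bsub>G\<^esub> z = z \<otimes>\<^bsub>G\<^esub> ?k"
        using gh z by (simp add: G.m_assoc G.inv_solve_left')
    qed (use gh in simp)
    then have "p ?k = \<one>\<^bsub>\<Phi>\<^esub>" unfolding kernel_def by blast
    moreover have "p ?k = inv\<^bsub>\<Phi>\<^esub> p h \<otimes>\<^bsub>\<Phi>\<^esub> p g"
      using p.hom_mult[OF G.inv_closed[OF gh(2)] gh(1)] p.hom_inv[OF gh(2)] by metis
    ultimately show "x = y"
      using \<Phi>.inv_mult_cancel(2)[OF p.hom_closed[OF gh(2)] p.hom_closed[OF gh(1)]]
        \<Phi>.r_one[OF p.hom_closed[OF gh(2)]] gh(3,4) by metis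
  qed
  moreover have "\<iota> (\<theta> (p g) v) = g \<otimes>\<^bsub>G\<^esub> \<iota> v \<otimes>\<^bsub>G\<^esub> inv\<^bsub>G\<^esub> g"
    if "g \<in> carrier G" "v \<in> carrier ?Z" for g v
    using c(2)[OF that] \<theta>[OF that(1)] by simp
  ultimately show ?thesis
    unfolding crystallographic_def using assms by blast
qed

section \<open>Transport along isomorphisms\<close>

lemma iso_restrict_image:
  assumes "f \<in> iso G H" "K \<subseteq> carrier G"
  shows "f \<in> iso (G\<lparr>carrier := K\<rparr>) (H\<lparr>carrier := f ` K\<rparr>)"
  using assms by (auto simp: iso_def hom_def bij_betw_def inj_on_subset subset_iff)

text \<open>Centers, torsion-freeness and crystallographic structures are carried along by isomorphisms;
  this lets the Bieberbach group be built in an explicit model of the quotient group.\<close>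

lemma center_iso_image:
  assumes G: "group G" and f: "f \<in> iso G H"
  shows "center H = f ` center G"
proof -
  have img: "f ` carrier G = carrier H" and inj: "inj_on f (carrier G)" and hom: "f \<in> hom G H"
    using f by (auto simp: iso_def bij_betw_def)
  interpret G: group G by fact
  have "f z \<in> center H \<longleftrightarrow> z \<in> center G" if z: "z \<in> carrier G" for z
  proof -
    have "f z \<otimes>\<^bsub>H\<^esub> f x = f x \<otimes>\<^bsub>H\<^esub> f z \<longleftrightarrow> z \<otimes>\<^bsub>G\<^esub> x = x \<otimes>\<^bsub>G\<^esub> z"
      if "x \<in> carrier G" for x
      using hom_mult[OF hom] inj_on_eq_iff[OF inj] z that G.m_closed by metis
    then show ?thesis using z by (auto simp: center_def img[symmetric])
  qed
  moreover have "center H \<subseteq> f ` carrier G" "center G \<subseteq> carrier G"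
    by (auto simp: center_def img)
  ultimately show ?thesis by blast
qed

lemma torsion_free_iso:
  assumes G: "group G" "group H" and f: "f \<in> iso G H" and tf: "torsion_free G"
  shows "torsion_free H"
  unfolding torsion_free_def
proof (intro ballI allI impI)
  fix y and k :: nat
  assume y: "y \<in> carrier H" and k: "k > 0" "y [^]\<^bsub>H\<^esub> k = \<one>\<^bsub>H\<^esub>"
  interpret f: group_hom G H f
    using f G by (simp add: group_hom_def group_hom_axioms_def iso_def)
  obtain x where x: "x \<in> carrier G" "y = f x" using f y by (auto simp: iso_def bij_betw_def)
  have "f (x [^]\<^bsub>G\<^esub> k) = f \<one>\<^bsub>G\<^esub>" using k x by (simp add: f.hom_nat_pow)
  then have "x [^]\<^bsub>G\<^esub> k = \<one>\<^bsub>G\<^esub>"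
    using f x(1) by (intro inj_onD[of f "carrier G"]) (simp_all add: iso_def bij_betw_def)
  then have "x = \<one>\<^bsub>G\<^esub>" using tf x k by (auto simp: torsion_free_def)
  then show "y = \<one>\<^bsub>H\<^esub>" using x by simp
qed

lemma crystallographic_iso:
  assumes H: "group H" and f: "f \<in> iso G H" and cr: "crystallographic G m \<Phi>"
  shows "crystallographic H m \<Phi>"
proof -
  let ?Z = "free_Abelian_group {..<m}"
  have G: "group G" and \<Phi>: "group \<Phi>" "finite (carrier \<Phi>)"
    using cr by (simp_all add: crystallographic_def)
  obtain \<iota> p \<theta> where \<iota>: "\<iota> \<in> mon ?Z G" and p: "p \<in> epi G \<Phi>"
    and img: "\<iota> ` carrier ?Z = kernel G \<Phi> p" and \<theta>: "\<theta> \<in> mon \<Phi> (AutoGroup ?Z)"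
    and conj: "\<forall>g\<in>carrier G. \<forall>v\<in>carrier ?Z. \<iota> (\<theta> (p g) v) = g \<otimes>\<^bsub>G\<^esub> \<iota> v \<otimes>\<^bsub>G\<^esub> inv\<^bsub>G\<^esub> g"
    using cr unfolding crystallographic_def by blast
  interpret f: group_hom G H f
    using f G H by (simp add: group_hom_def group_hom_axioms_def iso_def)
  interpret \<iota>: group_hom ?Z G \<iota>
    using \<iota> G by (simp add: group_hom_def group_hom_axioms_def mon_def)
  let ?g = "inv_into (carrier G) f"
  have g: "?g \<in> iso H G" using group.iso_set_sym[OF G f] .
  have inj: "inj_on f (carrier G)" and surj: "f ` carrier G = carrier H"
    using f by (auto simp: iso_def bij_betw_def)
  have gf: "?g (f x) = x" if "x \<in> carrier G" for x
    using inv_into_f_f[OF inj that] .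
  have obtain_pre: "\<exists>x\<in>carrier G. y = f x" if "y \<in> carrier H" for y
    using that surj by auto
  have "f \<circ> \<iota> \<in> mon ?Z H"
    using \<iota> inj \<iota>.hom_closed Group.hom_compose[of \<iota> ?Z G f H] f.homh
    by (auto simp: mon_def intro!: comp_inj_on inj_on_subset[OF inj])
  moreover have "p \<circ> ?g \<in> epi H \<Phi>"
  proof -
    have "?g ` carrier H = carrier G" "p ` carrier G = carrier \<Phi>"
      using g p by (simp_all add: iso_def bij_betw_def epi_def)
    then have "(p \<circ> ?g) ` carrier H = carrier \<Phi>" by (simp only: image_comp[symmetric])
    moreover have "p \<circ> ?g \<in> hom H \<Phi>"
      using p g by (intro Group.hom_compose[of ?g H G]) (simp_all add: epi_def iso_def)
    ultimately show ?thesis by (simp add: epi_def)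
  qed
  moreover have "(f \<circ> \<iota>) ` carrier ?Z = kernel H \<Phi> (p \<circ> ?g)"
  proof -
    have "kernel H \<Phi> (p \<circ> ?g) = f ` kernel G \<Phi> p"
      unfolding kernel_def surj[symmetric] by (auto simp: gf)
    then show ?thesis by (simp only: image_comp[symmetric] img)
  qed
  moreover have "\<forall>y\<in>carrier H. \<forall>v\<in>carrier ?Z.
      (f \<circ> \<iota>) (\<theta> ((p \<circ> ?g) y) v) = y \<otimes>\<^bsub>H\<^esub> (f \<circ> \<iota>) v \<otimes>\<^bsub>H\<^esub> inv\<^bsub>H\<^esub> y"
  proof (intro ballI)
    fix y v assume y: "y \<in> carrier H" and v: "v \<in> carrier ?Z"
    obtain x where x: "x \<in> carrier G" "y = f x" using obtain_pre[OF y] by blast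
    have "\<iota> v \<in> carrier G" using \<iota>.hom_closed[OF v] .
    then show "(f \<circ> \<iota>) (\<theta> ((p \<circ> ?g) y) v) = y \<otimes>\<^bsub>H\<^esub> (f \<circ> \<iota>) v \<otimes>\<^bsub>H\<^esub> inv\<^bsub>H\<^esub> y"
      using bspec[OF bspec[OF conj x(1)] v] x by (simp add: gf)
  qed
  ultimately show ?thesis
    unfolding crystallographic_def using H \<Phi> \<theta> by blast
qed

lemma bieberbach_iso:
  assumes "group G" "group H" "f \<in> iso G H" "bieberbach G m \<Phi>"
  shows "bieberbach H m \<Phi>"
  using assms crystallographic_iso torsion_free_iso unfolding bieberbach_def by metis

section \<open>Permutations acting on a lattice of pairs\<close>

definition pairs :: "nat \<Rightarrow> (nat \<times> nat) set"
  where "pairs n = {(i, j). i \<in> {1..n} \<and> j \<in> {1..n} \<and> i \<noteq> j}"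

text \<open>The permutation of coordinates for which \<open>pair_act \<pi>\<close> sends the basis vector at \<open>(i, j)\<close> to the
  one at \<open>(\<pi> i, \<pi> j)\<close>; the inverse appears because coordinates are pulled back.\<close>

definition pair_act :: "(nat \<Rightarrow> nat) \<Rightarrow> (nat \<times> nat \<Rightarrow>\<^sub>0 int) \<Rightarrow> nat \<times> nat \<Rightarrow>\<^sub>0 int"
  where "pair_act \<pi> = Poly_Mapping.map_key (map_prod (inv' \<pi>) (inv' \<pi>))"

text \<open>The semidirect product of the lattice on \<open>pairs n\<close> with the symmetric group.\<close>

definition pair_group :: "nat \<Rightarrow> ((nat \<times> nat \<Rightarrow>\<^sub>0 int) \<times> (nat \<Rightarrow> nat)) monoid" where
  "pair_group n =
    \<lparr>carrier = {v. Poly_Mapping.keys v \<subseteq> pairs n} \<times> {\<pi>. \<pi> permutes {1..n}},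
     monoid.mult = (\<lambda>x y. (fst x + pair_act (snd x) (fst y), snd x \<circ> snd y)),
     one = (0, id)\<rparr>"

lemma finite_pairs: "finite (pairs n)"
  by (rule finite_subset[of _ "{1..n} \<times> {1..n}"]) (auto simp: pairs_def)

lemma card_pairs: "card (pairs n) = n * (n - 1)"
proof -
  have "pairs n = {1..n} \<times> {1..n} - (\<lambda>i. (i, i)) ` {1..n}"
    by (auto simp: pairs_def)
  moreover have "card ((\<lambda>i. (i, i)) ` {1..n}) = n"
    by (simp add: card_image inj_on_def)
  ultimately have "card (pairs n) = n * n - n"
    by (simp add: card_Diff_subset image_subset_iff)
  then show ?thesis by (simp add: algebra_simps)
qed

context
  fixes \<pi> :: "nat \<Rightarrow> nat"
  assumes bij: "bij \<pi>"
begin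

lemma lookup_pair_act:
  "Poly_Mapping.lookup (pair_act \<pi> v) p
    = Poly_Mapping.lookup v (inv' \<pi> (fst p), inv' \<pi> (snd p))"
proof -
  have "inj (map_prod (inv' \<pi>) (inv' \<pi>))"
    using bij_is_inj[OF bij_imp_bij_inv[OF bij]] by (intro prod.inj_map)
  then show ?thesis
    unfolding pair_act_def by (cases p) (simp add: map_key.rep_eq)
qed

lemma lookup_pair_act_image:
  "Poly_Mapping.lookup (pair_act \<pi> v) (\<pi> i, \<pi> j) = Poly_Mapping.lookup v (i, j)"
  by (simp add: lookup_pair_act inv_f_f[OF bij_is_inj[OF bij]])

lemma pair_act_frag_of: "pair_act \<pi> (frag_of (i, j)) = frag_of (\<pi> i, \<pi> j)"
  by (rule poly_mapping_eqI)
    (auto simp: lookup_pair_act bij_inv_eq_iff[OF bij] inv_f_f[OF bij_is_inj[OF bij]])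

lemma pair_act_add: "pair_act \<pi> (u + v) = pair_act \<pi> u + pair_act \<pi> v"
  by (rule poly_mapping_eqI) (simp add: lookup_pair_act lookup_add)

lemma pair_act_zero: "pair_act \<pi> 0 = 0"
  by (rule poly_mapping_eqI) (simp add: lookup_pair_act)

end

lemma pair_act_id: "pair_act id v = v"
  by (rule poly_mapping_eqI) (simp add: lookup_pair_act)

lemma pair_act_comp:
  assumes "bij \<pi>" "bij \<tau>"
  shows "pair_act (\<pi> \<circ> \<tau>) v = pair_act \<pi> (pair_act \<tau> v)"
  by (rule poly_mapping_eqI)
    (simp add: lookup_pair_act[OF bij_comp[OF assms(2,1)]] lookup_pair_act[OF assms(1)]
      lookup_pair_act[OF assms(2)] o_inv_distrib[OF assms])

lemma keys_pair_act:
  assumes \<pi>: "\<pi> permutes {1..n}" and v: "Poly_Mapping.keys v \<subseteq> pairs n"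
  shows "Poly_Mapping.keys (pair_act \<pi> v) \<subseteq> pairs n"
proof
  fix p assume "p \<in> Poly_Mapping.keys (pair_act \<pi> v)"
  then have "(inv' \<pi> (fst p), inv' \<pi> (snd p)) \<in> pairs n"
    using v by (auto simp: in_keys_iff lookup_pair_act[OF permutes_bij[OF \<pi>]])
  then show "p \<in> pairs n"
    using permutes_in_image[OF permutes_inv[OF \<pi>]]
    unfolding pairs_def by (cases p) auto
qed

lemma group_pair_group: "group (pair_group n)"
proof (rule groupI)
  fix x y assume "x \<in> carrier (pair_group n)" "y \<in> carrier (pair_group n)"
  then show "x \<otimes>\<^bsub>pair_group n\<^esub> y \<in> carrier (pair_group n)"
    using order_trans[OF keys_add[of "fst x" "pair_act (snd x) (fst y)"], of "pairs n"]
      keys_pair_act[of "snd x" n "fst y"]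
    by (simp add: pair_group_def mem_Times_iff permutes_compose)
next
  fix x y z
  assume "x \<in> carrier (pair_group n)" "y \<in> carrier (pair_group n)" "z \<in> carrier (pair_group n)"
  then show "x \<otimes>\<^bsub>pair_group n\<^esub> y \<otimes>\<^bsub>pair_group n\<^esub> z = x \<otimes>\<^bsub>pair_group n\<^esub> (y \<otimes>\<^bsub>pair_group n\<^esub> z)"
    by (auto simp: pair_group_def pair_act_add permutes_bij pair_act_comp add.assoc)
next
  fix x assume x: "x \<in> carrier (pair_group n)"
  then show "\<one>\<^bsub>pair_group n\<^esub> \<otimes>\<^bsub>pair_group n\<^esub> x = x"
    by (auto simp: pair_group_def pair_act_id)
  obtain v \<pi> where v: "x = (v, \<pi>)" "Poly_Mapping.keys v \<subseteq> pairs n" "\<pi> permutes {1..n}"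
    using x by (auto simp: pair_group_def)
  let ?y = "(- pair_act (inv' \<pi>) v, inv' \<pi>)"
  have "?y \<in> carrier (pair_group n)"
    using keys_pair_act[OF permutes_inv[OF v(3)] v(2)] permutes_inv[OF v(3)]
    by (simp add: pair_group_def)
  moreover have "?y \<otimes>\<^bsub>pair_group n\<^esub> x = \<one>\<^bsub>pair_group n\<^esub>"
    by (simp add: pair_group_def v(1) permutes_inv_o[OF v(3)])
  ultimately show "\<exists>y\<in>carrier (pair_group n). y \<otimes>\<^bsub>pair_group n\<^esub> x = \<one>\<^bsub>pair_group n\<^esub>"
    by blast
qed (auto simp: pair_group_def permutes_id)

lemma carrier_pair_group:
  "(v, \<pi>) \<in> carrier (pair_group n) \<longleftrightarrow> Poly_Mapping.keys v \<subseteq> pairs n \<and> \<pi> permutes {1..n}"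
  by (simp add: pair_group_def)

lemma mult_pair_group:
  "(v, \<pi>) \<otimes>\<^bsub>pair_group n\<^esub> (w, \<tau>) = (v + pair_act \<pi> w, \<pi> \<circ> \<tau>)"
  by (simp add: pair_group_def)

lemma one_pair_group: "\<one>\<^bsub>pair_group n\<^esub> = (0, id)"
  by (simp add: pair_group_def)

lemma snd_pair_group_hom: "snd \<in> hom (pair_group n) (sym_group n)"
  by (auto simp: hom_def pair_group_def sym_group_def)

lemma Pair_id_hom: "(\<lambda>v. (v, id)) \<in> hom (free_Abelian_group (pairs n)) (pair_group n)"
  by (auto simp: hom_def carrier_pair_group mult_pair_group pair_act_id permutes_id)

text \<open>Both kinds of generators lie over the same transposition; the basis vector at \<open>(i, i + 1)\<close>
  records the difference between \<open>\<sigma>\<^sub>i\<close> and \<open>\<rho>\<^sub>i\<close>, that is, the pure element \<open>\<sigma>\<^sub>i \<rho>\<^sub>i\<close>.\<close>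

primrec vb_gen_pair :: "vb_gen \<Rightarrow> (nat \<times> nat \<Rightarrow>\<^sub>0 int) \<times> (nat \<Rightarrow> nat)" where
  "vb_gen_pair (Sig i) = (frag_of (i, i + 1), transpose i (i + 1))"
| "vb_gen_pair (Rho i) = (0, transpose i (i + 1))"

lemma snd_vb_gen_pair: "snd (vb_gen_pair x) = vb_gen_perm x"
  by (cases x) auto

lemma vb_gen_pair_closed: "vb_gen_pair \<in> vb_gens n \<rightarrow> carrier (pair_group n)"
  by (auto simp: vb_gens_def carrier_pair_group pairs_def intro!: permutes_swap_id)

text \<open>In the braid relation both sides have lattice part \<open>e\<^sub>i\<^sub>,\<^sub>i\<^sub>+\<^sub>1 + e\<^sub>i\<^sub>,\<^sub>i\<^sub>+\<^sub>2 + e\<^sub>i\<^sub>+\<^sub>1\<^sub>,\<^sub>i\<^sub>+\<^sub>2\<close>; the mixed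
  relation holds because \<open>\<rho>\<^sub>i \<rho>\<^sub>i\<^sub>+\<^sub>1\<close> carries \<open>(i, i + 1)\<close> to \<open>(i + 1, i + 2)\<close>.\<close>

lemma vb_gen_pair_rels:
  assumes "(l, r) \<in> vb_rels n"
  shows "word_eval (pair_group n) vb_gen_pair l = word_eval (pair_group n) vb_gen_pair r"
proof -
  note [simp] = mult_pair_group one_pair_group pair_act_frag_of pair_act_add pair_act_zero
  consider
      (braid) i where "i \<in> {1..n-2}" "l = [sg i, sg (i+1), sg i]" "r = [sg (i+1), sg i, sg (i+1)]"
    | (rho) i where "i \<in> {1..n-2}" "l = [rh i, rh (i+1), rh i]" "r = [rh (i+1), rh i, rh (i+1)]"
    | (mixed) i where "i \<in> {1..n-2}" "l = [rh i, rh (i+1), sg i]" "r = [sg (i+1), rh i, rh (i+1)]"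
    | (inv) i where "i \<in> {1..n-1}" "l = [rh i, rh i]" "r = []"
    | (far) a b i j where "a \<in> {sg, rh}" "b \<in> {sg, rh}" "i \<in> {1..n-1}" "j \<in> {1..n-1}" "\<bar>int i - int j\<bar> \<ge> 2"
        "l = [a i, b j]" "r = [b j, a i]"
    using assms unfolding vb_rels_def by blast
  then show ?thesis
  proof cases
    case braid
    then show ?thesis
      using transpose_braid[of i] by (simp add: transpose_eq_iff comp_assoc ac_simps)
  next
    case rho
    then show ?thesis using transpose_braid[of i] by (simp add: comp_assoc)
  next
    case mixed
    then show ?thesis using transpose_braid[of i] by (simp add: comp_assoc transpose_eq_iff)
  next
    case inv
    then show ?thesis by simp
  next
    case far
    then show ?thesis using transpose_far[of i j]  by (auto simp: comp_assoc transpose_eq_iff)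
  qed
qed

section \<open>Lifts of the symmetric group\<close>

text \<open>To bound a generated subgroup from above it suffices to multiply by one generator at a time.\<close>

lemma (in group) generate_subset_right_closed:
  assumes S: "S \<subseteq> carrier G" and inv: "\<And>s. s \<in> S \<Longrightarrow> inv s \<in> S"
    and D: "D \<subseteq> carrier G" "\<one> \<in> D" "\<And>d s. d \<in> D \<Longrightarrow> s \<in> S \<Longrightarrow> d \<otimes> s \<in> D"
  shows "generate G S \<subseteq> D"
proof
  fix x assume "x \<in> generate G S"
  then have "\<forall>d\<in>D. d \<otimes> x \<in> D"
  proof (induction rule: generate.induct)
    case (eng x y)
    then show ?case
      using generate_in_carrier[OF S] D(1) by (metis m_assoc subsetD)
  qed (use D inv in auto)
  then have "\<one> \<otimes> x \<in> D" using D(2) by blast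
  then show "x \<in> D" using generate_in_carrier[OF S \<open>x \<in> generate G S\<close>] by simp
qed

lemma (in group) generate_commutes:
  assumes S: "S \<subseteq> carrier G" and a: "a \<in> carrier G"
    and comm: "\<And>s. s \<in> S \<Longrightarrow> a \<otimes> s = s \<otimes> a" and x: "x \<in> generate G S"
  shows "a \<otimes> x = x \<otimes> a"
  using x
proof (induction rule: generate.induct)
  case (inv h)
  then have h: "h \<in> carrier G" using S by auto
  have "a \<otimes> inv h = inv h \<otimes> (h \<otimes> a) \<otimes> inv h"
    using h a by (simp add: m_assoc[symmetric])
  also have "\<dots> = inv h \<otimes> (a \<otimes> h) \<otimes> inv h"
    by (simp only: comm[OF inv])
  also have "\<dots> = inv h \<otimes> a"
    using h a by (simp add: m_assoc)
  finally show ?case .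
next
  case (eng x y)
  then show ?case
    using generate_in_carrier[OF S] a by (metis m_assoc)
qed (use a comm in auto)

text \<open>Elements \<open>r i\<close> that satisfy the Coxeter relations of the symmetric group and map to the adjacent
  transpositions. The aim is that they generate an isomorphic copy of the symmetric group, which
  amounts to the Coxeter presentation of the latter.\<close>

locale symmetric_lift = group G for G (structure) +
  fixes n :: nat and r :: "nat \<Rightarrow> 'a" and p :: "'a \<Rightarrow> nat \<Rightarrow> nat"
  assumes r_closed: "i \<in> {1..n-1} \<Longrightarrow> r i \<in> carrier G"
    and r_square: "i \<in> {1..n-1} \<Longrightarrow> r i \<otimes> r i = \<one>"
    and r_braid: "i \<in> {1..n-2} \<Longrightarrow> r i \<otimes> r (i+1) \<otimes> r i = r (i+1) \<otimes> r i \<otimes> r (i+1)"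
    and r_far: "i \<in> {1..n-1} \<Longrightarrow> j \<in> {1..n-1} \<Longrightarrow> \<bar>int i - int j\<bar> \<ge> 2 \<Longrightarrow> r i \<otimes> r j = r j \<otimes> r i"
    and p_hom: "p \<in> hom G (sym_group n)"
    and p_r: "i \<in> {1..n-1} \<Longrightarrow> p (r i) = transpose i (i+1)"
begin

definition R :: "nat \<Rightarrow> 'a set"
  where "R k = generate G (r ` {1..k})"

lemma R_gens: "k < n \<Longrightarrow> r ` {1..k} \<subseteq> carrier G"
  using r_closed by auto

lemma R_subgroup: "k < n \<Longrightarrow> subgroup (R k) G"
  unfolding R_def by (rule generate_is_subgroup[OF R_gens])

lemma R_closed: "k < n \<Longrightarrow> x \<in> R k \<Longrightarrow> x \<in> carrier G"
  using subgroup.mem_carrier[OF R_subgroup] .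

lemma R_mult: "k < n \<Longrightarrow> x \<in> R k \<Longrightarrow> y \<in> R k \<Longrightarrow> x \<otimes> y \<in> R k"
  using subgroup.m_closed[OF R_subgroup] .

lemma r_in_R: "i \<in> {1..k} \<Longrightarrow> r i \<in> R k"
  unfolding R_def by (auto intro: generate.incl)

lemma R_mono: "k \<le> l \<Longrightarrow> R k \<subseteq> R l"
  unfolding R_def by (rule mono_generate) auto

lemma R_0: "R 0 = {\<one>}"
  unfolding R_def by (simp add: generate_empty)

lemma r_inv: "i \<in> {1..n-1} \<Longrightarrow> inv (r i) = r i"
  using inv_equality[OF r_square r_closed r_closed] .

lemma r_commutes_R:
  assumes "k + 2 \<le> l" "l < n" "x \<in> R k"
  shows "r l \<otimes> x = x \<otimes> r l"
proof (rule generate_commutes[of "r ` {1..k}"])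
  show "x \<in> generate G (r ` {1..k})" using assms(3) by (simp add: R_def)
qed (use assms r_closed in \<open>auto intro!: r_far\<close>)

lemma p_mult: "x \<in> carrier G \<Longrightarrow> y \<in> carrier G \<Longrightarrow> p (x \<otimes> y) = p x \<circ> p y"
  using hom_mult[OF p_hom] by (simp add: sym_group_def)

lemma p_one: "p \<one> = id"
  using hom_one[OF p_hom is_group sym_group_is_group] by (simp add: sym_group_def)

lemma p_permutes: "x \<in> carrier G \<Longrightarrow> p x permutes {1..n}"
  using hom_in_carrier[OF p_hom] by (simp add: sym_group_def)

lemma p_inv: "x \<in> carrier G \<Longrightarrow> p (inv x) = inv' (p x)"
  using group_hom.hom_inv[of G "sym_group n" p x] p_hom sym_group_is_group hom_in_carrier[OF p_hom]
  by (simp add: group_hom_def group_hom_axioms_def is_group)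

text \<open>Write \<open>b\<close> for the last generator and \<open>a\<close> for the one before it. The only new products to
  consider are \<open>y b z b\<close> with \<open>y\<close>, \<open>z\<close> in the smaller subgroup. By induction \<open>z\<close> either commutes with
  \<open>b\<close>, and then \<open>b\<close> cancels, or it is \<open>u a v\<close> with \<open>u\<close>, \<open>v\<close> commuting with \<open>b\<close>, and then the braid
  relation turns \<open>b a b\<close> into \<open>a b a\<close>, with a single \<open>b\<close>.\<close>

lemma R_double_coset:
  assumes "Suc k < n" "x \<in> R (Suc k)"
  shows "x \<in> R k \<or> (\<exists>y\<in>R k. \<exists>z\<in>R k. x = y \<otimes> r (Suc k) \<otimes> z)"
  using assms
proof (induction k arbitrary: x)
  case (0 x)
  have "x \<in> {\<one>, r 1}"
  proof (rule subsetD[OF generate_subset_right_closed])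
    show "x \<in> generate G (r ` {1..1})" using 0 by (simp add: R_def)
  qed (use 0 r_closed r_square[of 1] r_inv[of 1] in auto)
  then show ?case using 0 r_closed[of 1] by (auto simp: R_0)
next
  case (Suc k x)
  let ?K = "R (Suc k)" and ?a = "r (Suc k)" and ?b = "r (Suc (Suc k))"
  let ?D = "?K \<union> {y \<otimes> ?b \<otimes> z | y z. y \<in> ?K \<and> z \<in> ?K}"
  have k: "k < n" "Suc k < n" using Suc.prems by auto
  have ab: "?a \<in> carrier G" "?b \<in> carrier G" "?a \<in> ?K"
    using Suc.prems r_closed r_in_R by auto
  have DI: "y \<otimes> ?b \<otimes> z \<in> ?D" if "y \<in> ?K" "z \<in> ?K" for y z
    using that by blast
  have "x \<in> ?D"
  proof (rule subsetD[OF generate_subset_right_closed])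
    show "x \<in> generate G (r ` {1..Suc (Suc k)})" using Suc.prems by (simp add: R_def)
    show "r ` {1..Suc (Suc k)} \<subseteq> carrier G" using Suc.prems(1) by (rule R_gens)
    show "inv s \<in> r ` {1..Suc (Suc k)}" if "s \<in> r ` {1..Suc (Suc k)}" for s
      using that Suc.prems(1) r_inv by auto
    show "?D \<subseteq> carrier G" using R_closed[OF k(2)] ab by auto
    show "\<one> \<in> ?D" using subgroup.one_closed[OF R_subgroup[OF k(2)]] by blast
    fix d s assume d: "d \<in> ?D" and s: "s \<in> r ` {1..Suc (Suc k)}"
    have last: "y \<otimes> ?b \<otimes> z \<otimes> ?b \<in> ?D" if y: "y \<in> ?K" and z: "z \<in> ?K" for y z
      using Suc.IH[OF k(2) z]
    proof
      assume zk: "z \<in> R k"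
      have "y \<otimes> ?b \<otimes> z \<otimes> ?b = y \<otimes> (?b \<otimes> z) \<otimes> ?b"
        using R_closed[OF k(2)] y z ab by (simp add: m_assoc)
      also have "?b \<otimes> z = z \<otimes> ?b"
        using r_commutes_R[of k "Suc (Suc k)" z] zk Suc.prems by simp
      also have "y \<otimes> (z \<otimes> ?b) \<otimes> ?b = y \<otimes> z"
        using R_closed[OF k(2)] y z ab r_square[of "Suc (Suc k)"] Suc.prems by (simp add: m_assoc)
      finally show ?thesis using R_mult[OF k(2) y z] by simp
    next
      assume "\<exists>u\<in>R k. \<exists>v\<in>R k. z = u \<otimes> ?a \<otimes> v"
      then obtain u v where uv: "u \<in> R k" "v \<in> R k" "z = u \<otimes> ?a \<otimes> v" by blast
      have uvK: "u \<in> ?K" "v \<in> ?K" using uv R_mono[of k "Suc k"] by auto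
      note cl = R_closed[OF k(2) uvK(1)] R_closed[OF k(2) uvK(2)] R_closed[OF k(2) y] ab
      have comm: "?b \<otimes> u = u \<otimes> ?b" "?b \<otimes> v = v \<otimes> ?b"
        using r_commutes_R[of k "Suc (Suc k)"] uv Suc.prems by simp_all
      have "y \<otimes> ?b \<otimes> z \<otimes> ?b = y \<otimes> (?b \<otimes> u) \<otimes> ?a \<otimes> (v \<otimes> ?b)"
        using cl uv by (simp add: m_assoc)
      also have "\<dots> = y \<otimes> (u \<otimes> ?b) \<otimes> ?a \<otimes> (?b \<otimes> v)"
        by (simp only: comm)
      also have "\<dots> = y \<otimes> u \<otimes> (?b \<otimes> ?a \<otimes> ?b) \<otimes> v"
        using cl by (simp add: m_assoc)
      also have "?b \<otimes> ?a \<otimes> ?b = ?a \<otimes> ?b \<otimes> ?a"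
        using r_braid[of "Suc k"] Suc.prems by simp
      also have "y \<otimes> u \<otimes> (?a \<otimes> ?b \<otimes> ?a) \<otimes> v = (y \<otimes> u \<otimes> ?a) \<otimes> ?b \<otimes> (?a \<otimes> v)"
        using cl by (simp add: m_assoc)
      finally show ?thesis
        using DI[OF R_mult[OF k(2) R_mult[OF k(2) y uvK(1)] ab(3)] R_mult[OF k(2) ab(3) uvK(2)]]
        by (simp only:)
    qed
    obtain i where i: "s = r i" "1 \<le> i" "i \<le> Suc (Suc k)" using s by auto
    consider "s \<in> ?K" | "s = ?b"
      using i r_in_R[of i "Suc k"] by (cases "i \<le> Suc k") (auto simp: le_Suc_eq)
    then show "d \<otimes> s \<in> ?D"
    proof cases
      case 1
      from d show ?thesis
      proof
        assume "d \<in> ?K" then show ?thesis using R_mult[OF k(2)] 1 by blast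
      next
        assume "d \<in> {y \<otimes> ?b \<otimes> z | y z. y \<in> ?K \<and> z \<in> ?K}"
        then obtain y z where yz: "d = y \<otimes> ?b \<otimes> z" "y \<in> ?K" "z \<in> ?K" by blast
        then have "d \<otimes> s = y \<otimes> ?b \<otimes> (z \<otimes> s)"
          using 1 R_closed[OF k(2)] ab by (simp add: m_assoc)
        then show ?thesis using DI[OF yz(2) R_mult[OF k(2) yz(3) 1]] by (simp only:)
      qed
    next
      case 2
      from d show ?thesis
      proof
        assume "d \<in> ?K"
        then have "d \<otimes> ?b = d \<otimes> ?b \<otimes> \<one>" using R_closed[OF k(2)] ab by simp
        then show ?thesis
          using DI[OF \<open>d \<in> ?K\<close> subgroup.one_closed[OF R_subgroup[OF k(2)]]] 2 by (simp only:)
      next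
        assume "d \<in> {y \<otimes> ?b \<otimes> z | y z. y \<in> ?K \<and> z \<in> ?K}"
        then show ?thesis using last 2 by blast
      qed
    qed
  qed
  then show ?case by blast
qed

lemma p_R_fixes:
  assumes "k < n" "x \<in> R k" "k + 1 < j"
  shows "p x j = j"
  using assms(2) unfolding R_def
proof (induction rule: generate.induct)
  case one
  show ?case by (simp add: p_one)
next
  case (incl h)
  then show ?case using assms p_r by (auto simp: transpose_eq_iff)
next
  case (inv h)
  then show ?case using assms p_r r_inv by (auto simp: transpose_eq_iff)
next
  case (eng h1 h2)
  then show ?case using p_mult R_closed[OF assms(1)] unfolding R_def by auto
qed

text \<open>In the nontrivial double coset \<open>x = y r\<^sub>k\<^sub>+\<^sub>1 z\<close>, the permutation of \<open>x\<close> moves the last point to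
  the place where \<open>y\<close> sends \<open>k + 1\<close>; as \<open>y\<close> fixes the last point, this is a different one.\<close>

lemma R_stabilizer:
  assumes k: "Suc k < n" and x: "x \<in> R (Suc k)" and fix_last: "p x (Suc (Suc k)) = Suc (Suc k)"
  shows "x \<in> R k"
proof (rule ccontr)
  assume "x \<notin> R k"
  then obtain y z where yz: "y \<in> R k" "z \<in> R k" "x = y \<otimes> r (Suc k) \<otimes> z"
    using R_double_coset[OF k x] by blast
  have kn: "k < n" using k by simp
  have cl: "y \<in> carrier G" "z \<in> carrier G" "r (Suc k) \<in> carrier G"
    using yz R_closed[OF kn] r_closed[of "Suc k"] k by auto
  have y: "p y (Suc (Suc k)) = Suc (Suc k)" and z: "p z (Suc (Suc k)) = Suc (Suc k)"
    using p_R_fixes[OF kn] yz by auto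
  have "p x (Suc (Suc k)) = p y (Suc k)"
    using p_r[of "Suc k"] k z cl yz(3) by (simp add: p_mult)
  then have "p y (Suc k) = p y (Suc (Suc k))" using y fix_last by simp
  then show False
    using inj_eq[OF permutes_inj[OF p_permutes[OF cl(1)]], of "Suc k" "Suc (Suc k)"] by simp
qed

text \<open>Descending along the stabilizers of the last points ends in the trivial subgroup.\<close>

lemma R_faithful:
  assumes "k < n" "x \<in> R k" "p x = id"
  shows "x = \<one>"
  using assms
proof (induction k)
  case 0
  then show ?case by (simp add: R_0)
next
  case (Suc k)
  then have "x \<in> R k" using R_stabilizer[OF Suc.prems(1,2)] by simp
  then show ?case using Suc by simp
qed

lemma R_transitive:
  assumes "k < n" "i \<in> {1..k+1}"
  shows "\<exists>x\<in>R k. p x i = k + 1"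
  using assms
proof (induction k)
  case 0
  then show ?case by (auto simp: R_0 p_one)
next
  case (Suc k)
  show ?case
  proof (cases "i = k + 2")
    case True
    then show ?thesis
      using subgroup.one_closed[OF R_subgroup[OF Suc.prems(1)]] by (intro bexI[of _ \<one>]) (simp_all add: p_one)
  next
    case False
    then obtain x where x: "x \<in> R k" "p x i = k + 1" using Suc by auto
    have "r (Suc k) \<otimes> x \<in> R (Suc k)"
      using x R_mono[of k "Suc k"] R_mult[OF Suc.prems(1)] r_in_R[of "Suc k"] by auto
    moreover have "p (r (Suc k) \<otimes> x) i = k + 2"
      using x R_closed[of k x] Suc.prems p_r[of "Suc k"] r_closed[of "Suc k"] by (simp add: p_mult)
    ultimately show ?thesis by auto
  qed
qed

lemma R_surjective:
  assumes "k < n" "\<pi> permutes {1..k+1}"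
  shows "\<exists>x\<in>R k. p x = \<pi>"
  using assms
proof (induction k arbitrary: \<pi>)
  case 0
  then have "\<pi> = id" by (simp add: permutes_sing)
  then show ?case by (auto simp: R_0 p_one)
next
  case (Suc k)
  let ?l = "Suc (Suc k)"
  have "\<pi> ?l \<in> {1..Suc k + 1}" using permutes_in_image[OF Suc.prems(2), of ?l] by simp
  then obtain x where x: "x \<in> R (Suc k)" "p x (\<pi> ?l) = ?l"
    using R_transitive[OF Suc.prems(1), of "\<pi> ?l"] by auto
  have xc: "x \<in> carrier G" using R_closed[OF Suc.prems(1) x(1)] .
  have px: "p x permutes {1..Suc k + 1}"
  proof (rule permutes_superset[OF p_permutes[OF xc]])
    fix j assume "j \<in> {1..n} - {1..Suc k + 1}"
    then show "p x j = j" using p_R_fixes[OF Suc.prems(1) x(1), of j] by auto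
  qed
  have "(p x \<circ> \<pi>) permutes {1..k+1}"
  proof (rule permutes_superset[OF permutes_compose[OF Suc.prems(2) px]])
    fix j assume "j \<in> {1..Suc k + 1} - {1..k + 1}"
    then have "j = ?l" by auto
    then show "(p x \<circ> \<pi>) j = j" using x(2) by simp
  qed
  then obtain y where y: "y \<in> R k" "p y = p x \<circ> \<pi>"
    using Suc.IH[OF Suc_lessD[OF Suc.prems(1)]] by blast
  have yR: "y \<in> R (Suc k)" using y(1) R_mono[of k "Suc k"] by auto
  have "inv x \<otimes> y \<in> R (Suc k)"
    using R_mult[OF Suc.prems(1) subgroup.m_inv_closed[OF R_subgroup[OF Suc.prems(1)] x(1)] yR] .
  moreover have "p (inv x \<otimes> y) = \<pi>"
    using R_closed[OF Suc.prems(1) yR] xc y(2) permutes_inv_o(2)[OF px]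
    by (simp add: p_mult p_inv o_assoc)
  ultimately show ?case by blast
qed

end

section \<open>Splitting the abelianized virtual braid group\<close>

lemma hom_free_Abelian_group_eqI:
  assumes "group G" "f \<in> hom (free_Abelian_group S) G" "g \<in> hom (free_Abelian_group S) G"
    and eq: "\<And>x. x \<in> S \<Longrightarrow> f (frag_of x) = g (frag_of x)" and v: "Poly_Mapping.keys v \<subseteq> S"
  shows "f v = g v"
proof -
  interpret f: group_hom "free_Abelian_group S" G f
    using assms(1,2) by (simp add: group_hom_def group_hom_axioms_def)
  interpret g: group_hom "free_Abelian_group S" G g
    using assms(1,3) by (simp add: group_hom_def group_hom_axioms_def)
  show ?thesis
  proof (rule free_Abelian_group_induct[OF v])
    show "f 0 = g 0" using f.hom_one g.hom_one by simp
  next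
    fix x y assume xy: "Poly_Mapping.keys x \<subseteq> S" "Poly_Mapping.keys y \<subseteq> S" "f x = g x" "f y = g y"
    have "x - y = x \<otimes>\<^bsub>free_Abelian_group S\<^esub> inv\<^bsub>free_Abelian_group S\<^esub> y"
      using xy by simp
    moreover have "x \<in> carrier (free_Abelian_group S)" "y \<in> carrier (free_Abelian_group S)"
      using xy by simp_all
    ultimately show "f (x - y) = g (x - y)"
      using xy(3,4) f.hom_mult f.hom_inv g.hom_mult g.hom_inv group.inv_closed[OF group_free_Abelian_group]
      by metis
  qed (rule eq)
qed

text \<open>The properties of the quotient of the virtual braid group by \<open>\<Gamma>\<^sub>2(VP\<^sub>n)\<close> that determine it: the
  defining relations in which some \<open>\<rho>\<^sub>i\<close> occurs, generation, a homomorphism \<open>\<phi>\<close> to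
  \<open>pair_group n\<close> with the values of \<open>vb_gen_pair\<close>, and commutativity of the elements over the
  identity permutation. Together they force \<open>\<phi>\<close> to be an isomorphism.\<close>

locale virtual_braid_lift = group G for G (structure) +
  fixes n :: nat and r s :: "nat \<Rightarrow> 'a" and \<phi> :: "'a \<Rightarrow> (nat \<times> nat \<Rightarrow>\<^sub>0 int) \<times> (nat \<Rightarrow> nat)"
  assumes n: "2 \<le> n"
    and r_closed: "i \<in> {1..n-1} \<Longrightarrow> r i \<in> carrier G"
    and s_closed: "i \<in> {1..n-1} \<Longrightarrow> s i \<in> carrier G"
    and r_square: "i \<in> {1..n-1} \<Longrightarrow> r i \<otimes> r i = \<one>"
    and r_braid: "i \<in> {1..n-2} \<Longrightarrow> r i \<otimes> r (i+1) \<otimes> r i = r (i+1) \<otimes> r i \<otimes> r (i+1)"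
    and r_r_s: "i \<in> {1..n-2} \<Longrightarrow> r i \<otimes> r (i+1) \<otimes> s i = s (i+1) \<otimes> r i \<otimes> r (i+1)"
    and r_far: "i \<in> {1..n-1} \<Longrightarrow> j \<in> {1..n-1} \<Longrightarrow> \<bar>int i - int j\<bar> \<ge> 2 \<Longrightarrow> r i \<otimes> r j = r j \<otimes> r i"
    and sr_far: "i \<in> {1..n-1} \<Longrightarrow> j \<in> {1..n-1} \<Longrightarrow> \<bar>int i - int j\<bar> \<ge> 2 \<Longrightarrow> s i \<otimes> r j = r j \<otimes> s i"
    and generated: "carrier G = generate G (r ` {1..n-1} \<union> s ` {1..n-1})"
    and \<phi>_hom: "\<phi> \<in> hom G (pair_group n)"
    and \<phi>_r: "i \<in> {1..n-1} \<Longrightarrow> \<phi> (r i) = (0, transpose i (i+1))"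
    and \<phi>_s: "i \<in> {1..n-1} \<Longrightarrow> \<phi> (s i) = (frag_of (i, i+1), transpose i (i+1))"
    and pure_commute: "x \<in> carrier G \<Longrightarrow> y \<in> carrier G \<Longrightarrow> snd (\<phi> x) = id \<Longrightarrow> snd (\<phi> y) = id
      \<Longrightarrow> x \<otimes> y = y \<otimes> x"
begin

sublocale \<phi>: group_hom G "pair_group n" \<phi>
  using \<phi>_hom by (simp add: group_hom_def group_hom_axioms_def is_group group_pair_group)

sublocale symmetric_lift G n r "snd \<circ> \<phi>"
proof
  show "snd \<circ> \<phi> \<in> hom G (sym_group n)"
    using Group.hom_compose[OF \<phi>_hom snd_pair_group_hom] .
qed (use r_closed r_square r_braid r_far \<phi>_r in simp_all)

lemma \<phi>_R:
  assumes "x \<in> R (n-1)"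
  shows "\<phi> x = (0, snd (\<phi> x))"
proof -
  have "fst (\<phi> x) = 0" using assms unfolding R_def
  proof (induction rule: generate.induct)
    case one
    show ?case by (simp add: one_pair_group)
  next
    case (incl h)
    then show ?case by (auto simp: \<phi>_r)
  next
    case (inv h)
    then show ?case by (auto simp: r_inv \<phi>_r)
  next
    case (eng x y)
    then have cl: "x \<in> carrier G" "y \<in> carrier G"
      using R_closed[of "n-1"] n by (simp_all add: R_def)
    then have "bij (snd (\<phi> x))" using permutes_bij[OF p_permutes] by simp
    then show ?case
      using eng cl by (simp add: pair_group_def pair_act_zero)
  qed
  then show ?thesis by (metis prod.collapse)
qed

text \<open>A preimage of the basis vector at \<open>(n - 1, n)\<close>. Its conjugates by the \<open>r i\<close> will be preimages of
  all the basis vectors. The last two points are the convenient choice because stabilizers of last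
  points are the subgroups \<open>R k\<close>.\<close>

definition last_pure :: 'a
  where "last_pure = s (n-1) \<otimes> r (n-1)"

lemma last_pure_closed: "last_pure \<in> carrier G"
  unfolding last_pure_def using r_closed s_closed n by simp

lemma \<phi>_last_pure: "\<phi> last_pure = (frag_of (n-1, n), id)"
  unfolding last_pure_def using r_closed[of "n-1"] s_closed[of "n-1"] n \<phi>_r[of "n-1"] \<phi>_s[of "n-1"]
  by (simp add: mult_pair_group pair_act_zero)

text \<open>An element of the symmetric subgroup that fixes the last two points is a word in
  \<open>r 1, \<dots>, r (n - 3)\<close>, and these generators are far from index \<open>n - 1\<close>.\<close>

lemma last_pure_commutes:
  assumes "x \<in> R (n-1)" "snd (\<phi> x) (n-1) = n-1" "snd (\<phi> x) n = n"
  shows "last_pure \<otimes> x = x \<otimes> last_pure"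
proof -
  have x: "x \<in> R (n-2)"
    using R_stabilizer[of "n-2" x] assms n by (simp add: Suc_diff_le numeral_2_eq_2 Suc_diff_Suc)
  have "x \<in> generate G (r ` {1..n-3})"
  proof (cases "n = 2")
    case True
    then show ?thesis using x by (simp add: R_def)
  next
    case False
    then have "Suc (n - 3) = n - 2" "Suc (n - 2) = n - 1" using n by auto
    then show ?thesis using R_stabilizer[of "n-3" x] x assms n by (simp add: R_def)
  qed
  then show ?thesis
  proof (rule generate_commutes[rotated -1])
    fix y assume "y \<in> r ` {1..n-3}"
    then obtain i where i: "y = r i" "i \<in> {1..n-3}" by blast
    have cl: "r i \<in> carrier G" "r (n-1) \<in> carrier G" "s (n-1) \<in> carrier G"
      using i n r_closed s_closed by auto
    have "last_pure \<otimes> y = s (n-1) \<otimes> (r (n-1) \<otimes> r i)"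
      using cl by (simp add: last_pure_def i m_assoc)
    also have "r (n-1) \<otimes> r i = r i \<otimes> r (n-1)"
      using i n by (intro r_far) auto
    also have "s (n-1) \<otimes> (r i \<otimes> r (n-1)) = (s (n-1) \<otimes> r i) \<otimes> r (n-1)"
      using cl by (simp add: m_assoc)
    also have "s (n-1) \<otimes> r i = r i \<otimes> s (n-1)"
      using i n by (intro sr_far) auto
    also have "r i \<otimes> s (n-1) \<otimes> r (n-1) = y \<otimes> last_pure"
      using cl by (simp add: last_pure_def i m_assoc)
    finally show "last_pure \<otimes> y = y \<otimes> last_pure" .
  qed (use R_gens[of "n-3"] n last_pure_closed in auto)
qed

text \<open>Move \<open>j\<close> to \<open>n\<close>, then the image of \<open>i\<close> to \<open>n - 1\<close> inside the stabilizer of \<open>n\<close>, and invert.\<close>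

lemma carries_last_pair:
  assumes "(i, j) \<in> pairs n"
  shows "\<exists>x\<in>R (n-1). snd (\<phi> x) (n-1) = i \<and> snd (\<phi> x) n = j"
proof -
  have ij: "i \<in> {1..n}" "j \<in> {1..n}" "i \<noteq> j" using assms by (auto simp: pairs_def)
  obtain y where y: "y \<in> R (n-1)" "snd (\<phi> y) j = n"
    using R_transitive[of "n-1" j] ij n by auto
  have yc: "y \<in> carrier G" using y(1) R_closed[of "n-1"] n by simp
  let ?i = "snd (\<phi> y) i"
  have py: "snd (\<phi> y) permutes {1..n}" using p_permutes[OF yc] by simp
  have "?i \<in> {1..n}" using permutes_in_image[OF py] ij by blast
  moreover have "?i \<noteq> n" using inj_eq[OF permutes_inj[OF py], of i j] y(2) ij by simp
  ultimately have "?i \<in> {1..n-2+1}" using n by auto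
  then obtain z where z: "z \<in> R (n-2)" "snd (\<phi> z) ?i = n-2+1"
    using R_transitive[of "n-2" ?i] n by auto
  have zn: "snd (\<phi> z) n = n" using p_R_fixes[of "n-2" z n] z n by simp
  have zR: "z \<in> R (n-1)" using z(1) R_mono[OF diff_le_mono2[of 1 2 n]] by auto
  have zc: "z \<in> carrier G" using zR R_closed[of "n-1"] n by simp
  have x: "z \<otimes> y \<in> R (n-1)" using R_mult[of "n-1"] y zR n by simp
  have pzy: "snd (\<phi> (z \<otimes> y)) = snd (\<phi> z) \<circ> snd (\<phi> y)"
    using p_mult[OF zc yc] by simp
  have eqs: "snd (\<phi> (z \<otimes> y)) i = n-1" "snd (\<phi> (z \<otimes> y)) j = n"
    using y z zn n by (simp_all add: pzy)
  have perm: "snd (\<phi> (z \<otimes> y)) permutes {1..n}" using p_permutes[of "z \<otimes> y"] yc zc by simp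
  have "snd (\<phi> (inv (z \<otimes> y))) = inv' (snd (\<phi> (z \<otimes> y)))"
    using p_inv[of "z \<otimes> y"] yc zc by simp
  then have "snd (\<phi> (inv (z \<otimes> y))) (n-1) = i" "snd (\<phi> (inv (z \<otimes> y))) n = j"
    using eqs permutes_inverses(2)[OF perm] by metis+
  moreover have "inv (z \<otimes> y) \<in> R (n-1)"
    using subgroup.m_inv_closed[OF R_subgroup x] n by simp
  ultimately show ?thesis by blast
qed

text \<open>The conjugate of \<open>last_pure\<close> by any symmetric element that carries \<open>(n - 1, n)\<close> to the given pair;
  it does not depend on the choice, since \<open>last_pure\<close> is fixed by the stabilizer of the pair.\<close>

definition pure_gen :: "nat \<times> nat \<Rightarrow> 'a" where
  "pure_gen ij = (let x = SOME x. x \<in> R (n-1) \<and> snd (\<phi> x) (n-1) = fst ij \<and> snd (\<phi> x) n = snd ij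
     in x \<otimes> last_pure \<otimes> inv x)"

lemma pure_gen_eq:
  assumes x: "x \<in> R (n-1)"
  shows "pure_gen (snd (\<phi> x) (n-1), snd (\<phi> x) n) = x \<otimes> last_pure \<otimes> inv x"
proof -
  define y where "y = (SOME y. y \<in> R (n-1) \<and> snd (\<phi> y) (n-1) = snd (\<phi> x) (n-1) \<and> snd (\<phi> y) n = snd (\<phi> x) n)"
  have y: "y \<in> R (n-1)" "snd (\<phi> y) (n-1) = snd (\<phi> x) (n-1)" "snd (\<phi> y) n = snd (\<phi> x) n"
    using someI[of "\<lambda>y. y \<in> R (n-1) \<and> snd (\<phi> y) (n-1) = snd (\<phi> x) (n-1) \<and> snd (\<phi> y) n = snd (\<phi> x) n" x] x
    unfolding y_def by simp_all
  have cl: "x \<in> carrier G" "y \<in> carrier G" using x y R_closed[of "n-1"] n by auto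
  let ?k = "inv x \<otimes> y"
  have k: "?k \<in> R (n-1)"
    using subgroup.m_inv_closed[OF R_subgroup x] R_mult[of "n-1"] y n by simp
  have perm: "snd (\<phi> x) permutes {1..n}" using p_permutes[OF cl(1)] by simp
  have pk: "snd (\<phi> ?k) = inv' (snd (\<phi> x)) \<circ> snd (\<phi> y)"
    using p_mult[of "inv x" y] p_inv[of x] cl by simp
  have fix_last: "snd (\<phi> ?k) (n-1) = n-1" "snd (\<phi> ?k) n = n"
    using y permutes_inverses(2)[OF perm] by (simp_all add: pk)
  have "y \<otimes> last_pure \<otimes> inv y = x \<otimes> (?k \<otimes> last_pure) \<otimes> inv y"
    using cl last_pure_closed by (simp add: m_assoc inv_mult_cancel)
  also have "\<dots> = x \<otimes> (last_pure \<otimes> ?k) \<otimes> inv y"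
    using last_pure_commutes[OF k fix_last] by simp
  also have "\<dots> = x \<otimes> last_pure \<otimes> inv x"
    using cl last_pure_closed by (simp add: m_assoc)
  finally show ?thesis by (simp add: pure_gen_def y_def)
qed

lemma pure_gen_cases:
  assumes "(i, j) \<in> pairs n"
  obtains x where "x \<in> R (n-1)" "snd (\<phi> x) (n-1) = i" "snd (\<phi> x) n = j"
    "pure_gen (i, j) = x \<otimes> last_pure \<otimes> inv x"
  using carries_last_pair[OF assms] pure_gen_eq by blast

lemma pure_gen_closed:
  assumes "ij \<in> pairs n"
  shows "pure_gen ij \<in> carrier G"
proof -
  obtain i j where ij: "ij = (i, j)" by force
  then obtain x where "x \<in> R (n-1)" "pure_gen ij = x \<otimes> last_pure \<otimes> inv x"
    using pure_gen_cases assms by metis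
  then show ?thesis using R_closed[of "n-1" x] n last_pure_closed by simp
qed

text \<open>Instead of computing an inverse in \<open>pair_group n\<close>, compare the images of both sides of
  \<open>pure_gen ij \<cdot> x = x \<cdot> last_pure\<close> and cancel.\<close>

lemma \<phi>_pure_gen:
  assumes "ij \<in> pairs n"
  shows "\<phi> (pure_gen ij) = (frag_of ij, id)"
proof -
  obtain i j where ij: "ij = (i, j)" by force
  then obtain x where x: "x \<in> R (n-1)" "snd (\<phi> x) (n-1) = i" "snd (\<phi> x) n = j"
    "pure_gen ij = x \<otimes> last_pure \<otimes> inv x"
    using pure_gen_cases assms by metis
  have cl: "x \<in> carrier G" using R_closed[of "n-1"] n x by simp
  have perm: "snd (\<phi> x) permutes {1..n}" using p_permutes[OF cl] by simp
  have "pure_gen ij \<otimes> x = x \<otimes> last_pure"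
    using cl last_pure_closed x(4) by (simp add: m_assoc)
  then have "\<phi> (pure_gen ij) \<otimes>\<^bsub>pair_group n\<^esub> \<phi> x = \<phi> x \<otimes>\<^bsub>pair_group n\<^esub> \<phi> last_pure"
    using cl last_pure_closed pure_gen_closed[OF assms] by (metis \<phi>.hom_mult)
  also have "\<phi> x = (0, snd (\<phi> x))" using \<phi>_R[OF x(1)] .
  also have "(0, snd (\<phi> x)) \<otimes>\<^bsub>pair_group n\<^esub> \<phi> last_pure = (frag_of ij, id) \<otimes>\<^bsub>pair_group n\<^esub> (0, snd (\<phi> x))"
    using x(2,3) permutes_bij[OF perm] by (simp add: \<phi>_last_pure mult_pair_group pair_act_frag_of pair_act_zero ij)
  finally show ?thesis
  proof (rule \<phi>.H.right_cancel[THEN iffD1, rotated -1])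
    show "(0, snd (\<phi> x)) \<in> carrier (pair_group n)" using perm by (simp add: carrier_pair_group)
    show "(frag_of ij, id) \<in> carrier (pair_group n)" using assms by (simp add: carrier_pair_group permutes_id)
  qed (use pure_gen_closed[OF assms] in auto)
qed

lemma conj_pure_gen:
  assumes y: "y \<in> R (n-1)" and ij: "(i, j) \<in> pairs n"
  shows "y \<otimes> pure_gen (i, j) \<otimes> inv y = pure_gen (snd (\<phi> y) i, snd (\<phi> y) j)"
proof -
  obtain x where x: "x \<in> R (n-1)" "snd (\<phi> x) (n-1) = i" "snd (\<phi> x) n = j"
    "pure_gen (i, j) = x \<otimes> last_pure \<otimes> inv x"
    using pure_gen_cases ij by metis
  have cl: "x \<in> carrier G" "y \<in> carrier G" using R_closed[of "n-1"] n x y by auto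
  have "y \<otimes> x \<in> R (n-1)" using R_mult[of "n-1"] x y n by simp
  then have "pure_gen (snd (\<phi> (y \<otimes> x)) (n-1), snd (\<phi> (y \<otimes> x)) n) = (y \<otimes> x) \<otimes> last_pure \<otimes> inv (y \<otimes> x)"
    by (rule pure_gen_eq)
  moreover have "snd (\<phi> (y \<otimes> x)) = snd (\<phi> y) \<circ> snd (\<phi> x)"
    using p_mult[OF cl(2,1)] by simp
  ultimately show ?thesis using x cl last_pure_closed by (simp add: m_assoc inv_mult_group)
qed

text \<open>Downward induction on \<open>i\<close> for the equivalent statement that \<open>s i \<cdot> r i\<close> is the pure generator at
  \<open>(i, i + 1)\<close>. The case \<open>i = n - 1\<close> is the definition of \<open>last_pure\<close>; the mixed relation together
  with the braid relation of the \<open>r i\<close> says that conjugation by \<open>r k \<cdot> r (k + 1)\<close> takes \<open>s k \<cdot> r k\<close>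
  to \<open>s (k + 1) \<cdot> r (k + 1)\<close>.\<close>

lemma s_eq_pure_gen:
  assumes "i \<in> {1..n-1}"
  shows "s i = pure_gen (i, i+1) \<otimes> r i"
proof -
  have "i \<le> n-1" using assms by simp
  then have "1 \<le> i \<longrightarrow> pure_gen (i, i+1) = s i \<otimes> r i"
  proof (induction i rule: inc_induct)
    case base
    have "\<one> \<in> R (n-1)" using subgroup.one_closed[OF R_subgroup] n by simp
    from pure_gen_eq[OF this] show ?case
      using n last_pure_closed by (simp add: one_pair_group last_pure_def)
  next
    case (step k)
    show ?case
    proof
      assume k1: "1 \<le> k"
      have k: "k \<in> {1..n-2}" "k \<in> {1..n-1}" "k+1 \<in> {1..n-1}" using step k1 by auto
      have IH: "pure_gen (k+1, k+2) = s (k+1) \<otimes> r (k+1)" using step by simp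
      have cl: "r k \<in> carrier G" "r (k+1) \<in> carrier G" "s k \<in> carrier G" "s (k+1) \<in> carrier G"
        using k r_closed s_closed by blast+
      let ?w = "r k \<otimes> r (k+1)"
      have w: "?w \<in> R (n-1)" "?w \<in> carrier G" using R_mult[of "n-1"] r_in_R k n cl by simp_all
      have kk: "(k, k+1) \<in> pairs n" using k by (auto simp: pairs_def)
      have pw: "snd (\<phi> ?w) = transpose k (k+1) \<circ> transpose (k+1) (k+2)"
        using p_mult[OF cl(1,2)] p_r k by simp
      have "?w \<otimes> pure_gen (k, k+1) \<otimes> inv ?w = pure_gen (snd (\<phi> ?w) k, snd (\<phi> ?w) (k+1))"
        by (rule conj_pure_gen[OF w(1) kk])
      also have "\<dots> = pure_gen (k+1, k+2)" unfolding pw by (simp add: transpose_def)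
      finally have "?w \<otimes> pure_gen (k, k+1) \<otimes> inv ?w = s (k+1) \<otimes> r (k+1)" using IH by simp
      then have "?w \<otimes> pure_gen (k, k+1) = s (k+1) \<otimes> r (k+1) \<otimes> ?w"
        using cl w pure_gen_closed[OF kk] by (metis inv_solve_right m_closed)
      also have "\<dots> = s (k+1) \<otimes> (r (k+1) \<otimes> r k \<otimes> r (k+1))"
        using cl by (simp add: m_assoc)
      also have "r (k+1) \<otimes> r k \<otimes> r (k+1) = r k \<otimes> r (k+1) \<otimes> r k"
        using r_braid[OF k(1)] by simp
      also have "s (k+1) \<otimes> (r k \<otimes> r (k+1) \<otimes> r k) = s (k+1) \<otimes> r k \<otimes> r (k+1) \<otimes> r k"
        using cl by (simp add: m_assoc)
      also have "s (k+1) \<otimes> r k \<otimes> r (k+1) = ?w \<otimes> s k"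
        using r_r_s[OF k(1)] by simp
      also have "?w \<otimes> s k \<otimes> r k = ?w \<otimes> (s k \<otimes> r k)"
        using cl by (simp add: m_assoc)
      finally show "pure_gen (k, k+1) = s k \<otimes> r k"
        using cl w pure_gen_closed[OF kk] by (metis l_cancel m_closed)
    qed
  qed
  then have "pure_gen (i, i+1) \<otimes> r i = s i \<otimes> (r i \<otimes> r i)"
    using assms r_closed[OF assms] s_closed[OF assms] by (simp add: m_assoc)
  then show ?thesis using r_square[OF assms] s_closed[OF assms] by simp
qed

definition pure :: "'a set"
  where "pure = {x \<in> carrier G. snd (\<phi> x) = id}"

lemma subgroup_pure: "subgroup pure G"
proof -
  have "pure = kernel G (sym_group n) (snd \<circ> \<phi>)"
    by (simp add: pure_def kernel_def sym_group_def)
  then show ?thesis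
    using group_hom.subgroup_kernel[of G "sym_group n" "snd \<circ> \<phi>"] p_hom sym_group_is_group
    by (simp add: group_hom_def group_hom_axioms_def is_group)
qed

lemma comm_group_pure: "comm_group (G\<lparr>carrier := pure\<rparr>)"
proof -
  interpret P: group "G\<lparr>carrier := pure\<rparr>"
    using subgroup.subgroup_is_group[OF subgroup_pure is_group] .
  show ?thesis
    by (rule P.group_comm_groupI) (auto simp: pure_def intro: pure_commute)
qed

text \<open>The pure generators lie over the identity permutation, so they commute and by freeness extend to a section of \<open>\<phi>\<close> over the lattice.\<close>

lemma obtain_lattice_hom:
  obtains h where "h \<in> hom (free_Abelian_group (pairs n)) G"
    "\<And>ij. ij \<in> pairs n \<Longrightarrow> h (frag_of ij) = pure_gen ij"
    "\<And>v. Poly_Mapping.keys v \<subseteq> pairs n \<Longrightarrow> \<phi> (h v) = (v, id)"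
proof -
  have "pure_gen ` pairs n \<subseteq> carrier (G\<lparr>carrier := pure\<rparr>)"
    using pure_gen_closed \<phi>_pure_gen by (auto simp: pure_def)
  then obtain h where h: "h \<in> hom (free_Abelian_group (pairs n)) (G\<lparr>carrier := pure\<rparr>)"
    "\<And>ij. ij \<in> pairs n \<Longrightarrow> h (frag_of ij) = pure_gen ij"
    using comm_group.free_Abelian_group_universal[OF comm_group_pure, of pure_gen "pairs n"] by auto
  have hG: "h \<in> hom (free_Abelian_group (pairs n)) G"
    using h(1) by (auto simp: hom_def pure_def)
  have "\<phi> (h v) = (v, id)" if "Poly_Mapping.keys v \<subseteq> pairs n" for v
  proof -
    have "(\<phi> \<circ> h) v = (\<lambda>v. (v, id)) v"
    proof (rule hom_free_Abelian_group_eqI[OF group_pair_group _ _ _ that])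
      show "\<phi> \<circ> h \<in> hom (free_Abelian_group (pairs n)) (pair_group n)"
        using Group.hom_compose[OF hG \<phi>_hom] .
      show "(\<lambda>v. (v, id)) \<in> hom (free_Abelian_group (pairs n)) (pair_group n)"
        by (rule Pair_id_hom)
    qed (simp_all add: h(2) \<phi>_pure_gen id_def)
    then show ?thesis by simp
  qed
  with hG h(2) show thesis by (rule that)
qed

text \<open>Every element is a lattice element \<open>h v\<close> times a symmetric element \<open>x\<close>: the set \<open>D\<close> of such
  products absorbs the generators on the right, because conjugation by \<open>x\<close> permutes the pure
  generators and \<open>s i\<close> is a pure generator times \<open>r i\<close>. Since \<open>\<phi> (h v \<cdot> x)\<close> has lattice part \<open>v\<close> and
  the same permutation as \<open>x\<close>, and \<open>x\<close> is determined by its permutation, \<open>\<phi>\<close> is injective.\<close>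

theorem \<phi>_iso: "\<phi> \<in> iso G (pair_group n)"
proof -
  let ?F = "free_Abelian_group (pairs n)"
  obtain h where h: "h \<in> hom ?F G" "\<And>ij. ij \<in> pairs n \<Longrightarrow> h (frag_of ij) = pure_gen ij"
    "\<And>v. Poly_Mapping.keys v \<subseteq> pairs n \<Longrightarrow> \<phi> (h v) = (v, id)"
    using obtain_lattice_hom by metis
  interpret h: group_hom ?F G h
    using h(1) by (simp add: group_hom_def group_hom_axioms_def is_group)
  let ?R = "R (n-1)"
  have n1: "n - 1 < n" using n by simp
  have h_closed: "h v \<in> carrier G" if "Poly_Mapping.keys v \<subseteq> pairs n" for v
    using h.hom_closed that by simp
  define D where "D = {h v \<otimes> x | v x. Poly_Mapping.keys v \<subseteq> pairs n \<and> x \<in> ?R}"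
  have DI: "h v \<otimes> x \<in> D" if "Poly_Mapping.keys v \<subseteq> pairs n" "x \<in> ?R" for v x
    using that by (auto simp: D_def)
  have D_mult_r: "d \<otimes> y \<in> D" if d: "d \<in> D" and y: "y \<in> ?R" for d y
  proof -
    obtain v x where vx: "d = h v \<otimes> x" "Poly_Mapping.keys v \<subseteq> pairs n" "x \<in> ?R"
      using d by (auto simp: D_def)
    then have "d \<otimes> y = h v \<otimes> (x \<otimes> y)" using h_closed R_closed[OF n1] y by (simp add: m_assoc)
    then show ?thesis using DI[OF vx(2) R_mult[OF n1 vx(3) y]] by simp
  qed
  have D_mult_pure_gen: "d \<otimes> pure_gen ij \<in> D" "d \<otimes> inv (pure_gen ij) \<in> D" if d: "d \<in> D" and ij: "ij \<in> pairs n" for d ij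
  proof -
    obtain v x where vx: "d = h v \<otimes> x" "Poly_Mapping.keys v \<subseteq> pairs n" "x \<in> ?R"
      using d by (auto simp: D_def)
    obtain i j where ij_eq: "ij = (i, j)" by force
    have xc: "x \<in> carrier G" using vx R_closed[OF n1] by simp
    have perm: "snd (\<phi> x) permutes {1..n}" using p_permutes[OF xc] by simp
    let ?kl = "(snd (\<phi> x) i, snd (\<phi> x) j)"
    have kl: "?kl \<in> pairs n"
      using ij ij_eq permutes_in_image[OF perm] inj_eq[OF permutes_inj[OF perm]]
      by (auto simp: pairs_def)
    have conj: "x \<otimes> pure_gen ij \<otimes> inv x = h (frag_of ?kl)"
      using conj_pure_gen[OF vx(3)] ij ij_eq h(2)[OF kl] by simp
    have cl: "h v \<in> carrier G" "pure_gen ij \<in> carrier G" "h (frag_of ?kl) \<in> carrier G"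
      using h_closed[OF vx(2)] pure_gen_closed[OF ij] h_closed[of "frag_of ?kl"] kl by simp_all
    have xs: "x \<otimes> pure_gen ij = h (frag_of ?kl) \<otimes> x"
      using conj cl xc by (metis inv_solve_right m_closed)
    have "d \<otimes> pure_gen ij = h v \<otimes> h (frag_of ?kl) \<otimes> x"
      using xs cl xc vx(1) by (simp add: m_assoc)
    also have "h v \<otimes> h (frag_of ?kl) = h (v + frag_of ?kl)"
      using h.hom_mult[of v "frag_of ?kl"] vx(2) kl by simp
    finally show "d \<otimes> pure_gen ij \<in> D"
      using DI[of "v + frag_of ?kl" x] vx kl keys_add[of v "frag_of ?kl"] by (auto simp: subset_iff)
    have "x \<otimes> inv (pure_gen ij) \<otimes> inv x = inv (h (frag_of ?kl))"
      using cl xc by (simp add: conj[symmetric] inv_mult_group m_assoc)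
    also have "\<dots> = h (- frag_of ?kl)"
      using h.hom_inv[of "frag_of ?kl"] kl by simp
    finally have conj': "x \<otimes> inv (pure_gen ij) \<otimes> inv x = h (- frag_of ?kl)" .
    have cl': "h (- frag_of ?kl) \<in> carrier G" using h_closed[of "- frag_of ?kl"] kl by simp
    have xs': "x \<otimes> inv (pure_gen ij) = h (- frag_of ?kl) \<otimes> x"
      using conj' cl cl' xc by (metis inv_solve_right m_closed inv_closed)
    have "d \<otimes> inv (pure_gen ij) = h v \<otimes> h (- frag_of ?kl) \<otimes> x"
      using xs' cl cl' xc vx(1) by (simp add: m_assoc)
    also have "h v \<otimes> h (- frag_of ?kl) = h (v + - frag_of ?kl)"
      using h.hom_mult[of v "- frag_of ?kl"] vx(2) kl by simp
    finally show "d \<otimes> inv (pure_gen ij) \<in> D"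
      using DI[of "v + - frag_of ?kl" x] vx kl keys_add[of v "- frag_of ?kl"] by (auto simp: subset_iff)
  qed
  have DG: "D \<subseteq> carrier G" using h_closed R_closed[OF n1] by (auto simp: D_def)
  let ?S = "r ` {1..n-1} \<union> s ` {1..n-1} \<union> (\<lambda>i. inv (s i)) ` {1..n-1}"
  have all_D: "carrier G \<subseteq> D"
  proof (rule order_trans[OF _ generate_subset_right_closed])
    show "carrier G \<subseteq> generate G ?S"
      using mono_generate[of "r ` {1..n-1} \<union> s ` {1..n-1}" ?S] generated by auto
    show "?S \<subseteq> carrier G" using r_closed s_closed by auto
    show "inv x \<in> ?S" if "x \<in> ?S" for x using that s_closed r_inv by auto
    have "h 0 = \<one>" using h.hom_one by simp
    then show "\<one> \<in> D" using DI[of 0 \<one>] subgroup.one_closed[OF R_subgroup[OF n1]] by simp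
    fix d x assume d: "d \<in> D" and x: "x \<in> ?S"
    have dc: "d \<in> carrier G" using d DG by blast
    from x consider i where "i \<in> {1..n-1}" "x = r i" | i where "i \<in> {1..n-1}" "x = s i"
      | i where "i \<in> {1..n-1}" "x = inv (s i)" by blast
    then show "d \<otimes> x \<in> D"
    proof cases
      case 1
      then show ?thesis using D_mult_r[OF d r_in_R] by simp
    next
      case (2 i)
      have ii: "(i, i+1) \<in> pairs n" using 2 by (auto simp: pairs_def)
      have "d \<otimes> x = d \<otimes> pure_gen (i, i+1) \<otimes> r i"
        using 2 s_eq_pure_gen[OF 2(1)] pure_gen_closed[OF ii] r_closed[OF 2(1)] dc by (simp add: m_assoc)
      then show ?thesis using D_mult_r[OF D_mult_pure_gen(1)[OF d ii] r_in_R[OF 2(1)]] by simp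
    next
      case (3 i)
      have ii: "(i, i+1) \<in> pairs n" using 3 by (auto simp: pairs_def)
      have "d \<otimes> x = d \<otimes> r i \<otimes> inv (pure_gen (i, i+1))"
        using 3 s_eq_pure_gen[OF 3(1)] pure_gen_closed[OF ii] r_closed[OF 3(1)] dc r_inv[OF 3(1)]
        by (simp add: m_assoc inv_mult_group)
      then show ?thesis using D_mult_pure_gen(2)[OF D_mult_r[OF d r_in_R[OF 3(1)]] ii] by simp
    qed
  qed (rule DG)
  have \<phi>_D: "\<phi> (h v \<otimes> x) = (v, snd (\<phi> x))" if "Poly_Mapping.keys v \<subseteq> pairs n" "x \<in> ?R" for v x
  proof -
    have "\<phi> (h v \<otimes> x) = (v, id) \<otimes>\<^bsub>pair_group n\<^esub> (0, snd (\<phi> x))"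
      using \<phi>.hom_mult[OF h_closed[OF that(1)] R_closed[OF n1 that(2)]] h(3)[OF that(1)]
        \<phi>_R[OF that(2)] by metis
    then show ?thesis by (simp add: mult_pair_group pair_act_zero)
  qed
  have "\<phi> x = \<one>\<^bsub>pair_group n\<^esub> \<Longrightarrow> x = \<one>" if "x \<in> carrier G" for x
  proof -
    assume one: "\<phi> x = \<one>\<^bsub>pair_group n\<^esub>"
    have "x \<in> D" using all_D that by blast
    then obtain v y where vy: "x = h v \<otimes> y" "Poly_Mapping.keys v \<subseteq> pairs n" "y \<in> ?R"
      unfolding D_def by blast
    then have "v = 0" "snd (\<phi> y) = id" using \<phi>_D[OF vy(2,3)] one by (simp_all add: one_pair_group)
    then show "x = \<one>" using R_faithful[OF n1 vy(3)] vy(1) h.hom_one by simp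
  qed
  moreover have "\<phi> ` carrier G = carrier (pair_group n)"
  proof
    show "carrier (pair_group n) \<subseteq> \<phi> ` carrier G"
    proof
      fix t assume t: "t \<in> carrier (pair_group n)"
      obtain v \<pi> where v: "t = (v, \<pi>)" "Poly_Mapping.keys v \<subseteq> pairs n" "\<pi> permutes {1..n}"
        using t by (cases t) (auto simp: carrier_pair_group)
      have "\<pi> permutes {1..n-1+1}" using v(3) n by simp
      then obtain x where x: "x \<in> ?R" "snd (\<phi> x) = \<pi>"
        using R_surjective[OF n1] by fastforce
      have "\<phi> (h v \<otimes> x) = t" using \<phi>_D[OF v(2) x(1)] x(2) v(1) by simp
      then show "t \<in> \<phi> ` carrier G"
        using h_closed[OF v(2)] R_closed[OF n1 x(1)] by blast
    qed
  qed auto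
  ultimately show ?thesis
    using \<phi>.iso_iff by blast
qed

end

section \<open>The quotient of the virtual braid group\<close>

lemma word_eval_hom:
  assumes "group G" "group H" "h \<in> hom G H" "f \<in> S \<rightarrow> carrier G" "w \<in> words S"
  shows "h (word_eval G f w) = word_eval H (h \<circ> f) w"
proof -
  interpret h: group_hom G H h
    using assms by (simp add: group_hom_def group_hom_axioms_def)
  show ?thesis
    using assms(5)
  proof (induction w)
    case Nil
    show ?case by simp
  next
    case (Cons a w)
    obtain x b where a: "a = (x, b)" by force
    have "f x \<in> carrier G" "w \<in> words S" using Cons.hyps assms(4) a by auto
    moreover have "word_eval G f w \<in> carrier G"
      using group.word_eval_closed[OF assms(1,4)] calculation(2) .
    ultimately show ?case using Cons.IH a by simp
  qed
qed

definition vb_coset :: "nat \<Rightarrow> vb_gen word \<Rightarrow> vb_gen word set set"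
  where "vb_coset n w = derived (VB n) (VP n) #>\<^bsub>VB n\<^esub> pres_class (vb_gens n) (vb_rels n) w"

context
  fixes n :: nat
begin

interpretation V: group "VB n" by (rule group_VB)

interpretation perm: group_hom "VB n" "sym_group n" "vb_perm n"
  by (simp add: group_hom_def group_hom_axioms_def group_VB sym_group_is_group vb_perm_hom)

lemma VP_normal: "VP n \<lhd> VB n"
  by (simp add: VP_def perm.normal_kernel)

lemma derived_VP_normal: "derived (VB n) (VP n) \<lhd> VB n"
  using V.derived_is_normal[OF VP_normal] .

interpretation D: normal "derived (VB n) (VP n)" "VB n"
  by (rule derived_VP_normal)

lemma carrier_VB: "carrier (VB n) = pres_class (vb_gens n) (vb_rels n) ` words (vb_gens n)"
  by (simp add: VB_def presented_group_def)

lemma carrier_quotient: "carrier (VB_mod_Gamma2_VP n) = vb_coset n ` words (vb_gens n)"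
  by (auto simp: VB_mod_Gamma2_VP_def carrier_FactGroup carrier_VB vb_coset_def)

lemma vb_coset_append:
  assumes "v \<in> words (vb_gens n)" "w \<in> words (vb_gens n)"
  shows "vb_coset n (v @ w) = vb_coset n v \<otimes>\<^bsub>VB_mod_Gamma2_VP n\<^esub> vb_coset n w"
proof -
  have "pres_class (vb_gens n) (vb_rels n) (v @ w)
      = pres_class (vb_gens n) (vb_rels n) v \<otimes>\<^bsub>VB n\<^esub> pres_class (vb_gens n) (vb_rels n) w"
    using pres_class_mult[OF assms] by (simp add: VB_def)
  then show ?thesis
    using assms D.rcos_sum by (simp add: vb_coset_def VB_mod_Gamma2_VP_def carrier_VB)
qed

lemma vb_coset_Nil: "vb_coset n [] = \<one>\<^bsub>VB_mod_Gamma2_VP n\<^esub>"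
proof -
  have "pres_class (vb_gens n) (vb_rels n) [] = \<one>\<^bsub>VB n\<^esub>"
    by (simp add: VB_def presented_group_def)
  then show ?thesis
    using V.coset_mult_one[OF D.subset] by (simp add: vb_coset_def VB_mod_Gamma2_VP_def)
qed

lemma vb_coset_rel:
  assumes "(l, r) \<in> vb_rels n" "l \<in> words (vb_gens n)" "r \<in> words (vb_gens n)"
  shows "vb_coset n l = vb_coset n r"
proof -
  have "pres_eq (vb_gens n) (vb_rels n) l r"
    using pres_eq.rel[of "[]" "vb_gens n" "[]" l r "vb_rels n"] assms by simp
  then have "pres_class (vb_gens n) (vb_rels n) l = pres_class (vb_gens n) (vb_rels n) r"
    using pres_class_eq_iff[OF assms(2,3)] by blast
  then show ?thesis by (simp add: vb_coset_def)
qed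

lemma vb_coset_inv:
  assumes "x \<in> vb_gens n"
  shows "vb_coset n [(x, False)] = inv\<^bsub>VB_mod_Gamma2_VP n\<^esub> vb_coset n [(x, True)]"
proof -
  let ?w = "[(x, False), (x, True)]"
  have "pres_eq (vb_gens n) (vb_rels n) ?w []"
    using pres_eq.cancel[of "[]" "vb_gens n" "[]" x "vb_rels n" False] assms by simp
  then have "pres_class (vb_gens n) (vb_rels n) ?w = pres_class (vb_gens n) (vb_rels n) []"
    using pres_class_eq_iff[of ?w "vb_gens n" "[]"] assms by simp
  then have "vb_coset n ?w = vb_coset n []" by (simp add: vb_coset_def)
  then have "vb_coset n [(x, False)] \<otimes>\<^bsub>VB_mod_Gamma2_VP n\<^esub> vb_coset n [(x, True)]
      = \<one>\<^bsub>VB_mod_Gamma2_VP n\<^esub>"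
    using vb_coset_append[of "[(x, False)]" "[(x, True)]"] assms by (simp add: vb_coset_Nil)
  moreover have "vb_coset n [(x, b)] \<in> carrier (VB_mod_Gamma2_VP n)" for b
    using assms by (simp add: carrier_quotient)
  ultimately show ?thesis
    using group.inv_equality[OF group_VB_mod_Gamma2_VP] by metis
qed

lemma vb_coset_gens_generate:
  "carrier (VB_mod_Gamma2_VP n)
    = generate (VB_mod_Gamma2_VP n) ((\<lambda>x. vb_coset n [(x, True)]) ` vb_gens n)" (is "_ = generate _ ?S")
proof
  have "vb_coset n w \<in> generate (VB_mod_Gamma2_VP n) ?S" if "w \<in> words (vb_gens n)" for w
    using that
  proof (induction w)
    case Nil
    show ?case unfolding vb_coset_Nil by (rule generate.one)
  next
    case (Cons a w)
    obtain x b where a: "a = (x, b)" "x \<in> vb_gens n" using Cons.hyps by (cases a) auto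
    have "vb_coset n (a # w) = vb_coset n [a] \<otimes>\<^bsub>VB_mod_Gamma2_VP n\<^esub> vb_coset n w"
      using vb_coset_append[of "[a]" w] Cons.hyps by simp
    moreover have "vb_coset n [a] \<in> generate (VB_mod_Gamma2_VP n) ?S"
      using a vb_coset_inv[OF a(2)]
      by (cases b) (auto intro: generate.incl generate.inv)
    ultimately show ?case using generate.eng[OF _ Cons.IH] by simp
  qed
  then show "carrier (VB_mod_Gamma2_VP n) \<subseteq> generate (VB_mod_Gamma2_VP n) ?S"
    by (auto simp: carrier_quotient)
  have "?S \<subseteq> carrier (VB_mod_Gamma2_VP n)" by (auto simp: carrier_quotient)
  then show "generate (VB_mod_Gamma2_VP n) ?S \<subseteq> carrier (VB_mod_Gamma2_VP n)"
    by (rule group.generate_incl[OF group_VB_mod_Gamma2_VP])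
qed

text \<open>On the virtual braid group, the homomorphism given by \<open>vb_gen_pair\<close> lies over the permutation
  homomorphism. It maps the pure subgroup to the lattice, which is abelian, so it kills the
  commutators of pure elements and descends to the quotient.\<close>

lemma obtain_pair_hom:
  obtains \<phi> where "\<phi> \<in> hom (VB_mod_Gamma2_VP n) (pair_group n)"
    "\<And>x. x \<in> vb_gens n \<Longrightarrow> \<phi> (vb_coset n [(x, True)]) = vb_gen_pair x"
    "\<And>x y. x \<in> carrier (VB_mod_Gamma2_VP n) \<Longrightarrow> y \<in> carrier (VB_mod_Gamma2_VP n) \<Longrightarrow>
      snd (\<phi> x) = id \<Longrightarrow> snd (\<phi> y) = id \<Longrightarrow>
      x \<otimes>\<^bsub>VB_mod_Gamma2_VP n\<^esub> y = y \<otimes>\<^bsub>VB_mod_Gamma2_VP n\<^esub> x"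
proof -
  let ?T = "pair_group n" and ?D = "derived (VB n) (VP n)"
  interpret T: group ?T by (rule group_pair_group)
  let ?h = "pres_hom ?T vb_gen_pair"
  have h_hom: "?h \<in> hom (VB n) ?T"
    unfolding VB_def by (rule T.pres_hom_hom[OF vb_gen_pair_closed vb_gen_pair_rels])
  interpret h: group_hom "VB n" ?T ?h
    using h_hom by (simp add: group_hom_def group_hom_axioms_def group_VB group_pair_group)
  have h_class: "?h (pres_class (vb_gens n) (vb_rels n) w) = word_eval ?T vb_gen_pair w"
    if "w \<in> words (vb_gens n)" for w
    using T.pres_hom_class[OF vb_gen_pair_closed vb_gen_pair_rels that] by blast
  have snd_h: "snd (?h x) = vb_perm n x" if x: "x \<in> carrier (VB n)" for x
  proof -
    obtain w where w: "w \<in> words (vb_gens n)" "x = pres_class (vb_gens n) (vb_rels n) w"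
      using x carrier_VB by blast
    have "snd (?h x) = word_eval (sym_group n) (snd \<circ> vb_gen_pair) w"
      using word_eval_hom[OF group_pair_group sym_group_is_group snd_pair_group_hom vb_gen_pair_closed w(1)]
        h_class[OF w(1)] w(2) by simp
    also have "snd \<circ> vb_gen_pair = vb_gen_perm" by (simp add: fun_eq_iff snd_vb_gen_pair)
    also have "word_eval (sym_group n) vb_gen_perm w = vb_perm n x"
      using group.pres_hom_class[OF sym_group_is_group vb_gen_perm_closed vb_gen_perm_rels w(1)] w(2)
      by (simp add: vb_perm_def)
    finally show ?thesis .
  qed
  have VP_eq: "VP n = {x \<in> carrier (VB n). snd (?h x) = id}"
    using snd_h by (auto simp: VP_def kernel_def sym_group_one)
  have VP_comm: "?h x \<otimes>\<^bsub>?T\<^esub> ?h y = ?h y \<otimes>\<^bsub>?T\<^esub> ?h x" if "x \<in> VP n" "y \<in> VP n" for x y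
  proof -
    have "snd (?h x) = id" "snd (?h y) = id" using that by (simp_all add: VP_eq)
    then have "?h x = (fst (?h x), id)" "?h y = (fst (?h y), id)" by (simp_all add: prod_eq_iff)
    then obtain u v where "?h x = (u, id)" "?h y = (v, id)" by blast
    then show ?thesis by (simp add: mult_pair_group pair_act_id add.commute)
  qed
  have "derived_set (VB n) (VP n) \<subseteq> kernel (VB n) ?T ?h"
  proof
    fix z assume "z \<in> derived_set (VB n) (VP n)"
    then obtain x y where xy: "x \<in> VP n" "y \<in> VP n"
      "z = x \<otimes>\<^bsub>VB n\<^esub> y \<otimes>\<^bsub>VB n\<^esub> inv\<^bsub>VB n\<^esub> x \<otimes>\<^bsub>VB n\<^esub> inv\<^bsub>VB n\<^esub> y" by blast
    have cl: "x \<in> carrier (VB n)" "y \<in> carrier (VB n)" using xy VP_eq by auto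
    have "?h z = ?h x \<otimes>\<^bsub>?T\<^esub> ?h y \<otimes>\<^bsub>?T\<^esub> inv\<^bsub>?T\<^esub> ?h x \<otimes>\<^bsub>?T\<^esub> inv\<^bsub>?T\<^esub> ?h y"
      using cl by (simp add: xy(3))
    also have "\<dots> = ?h y \<otimes>\<^bsub>?T\<^esub> ?h x \<otimes>\<^bsub>?T\<^esub> inv\<^bsub>?T\<^esub> ?h x \<otimes>\<^bsub>?T\<^esub> inv\<^bsub>?T\<^esub> ?h y"
      by (simp only: VP_comm[OF xy(1,2)])
    also have "\<dots> = \<one>\<^bsub>?T\<^esub>" using cl by (simp add: T.m_assoc)
    finally show "z \<in> kernel (VB n) ?T ?h" using cl xy(3) by (simp add: kernel_def)
  qed
  then have D_kernel: "?D \<subseteq> kernel (VB n) ?T ?h"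
    unfolding derived_def by (rule V.generate_subgroup_incl[OF _ h.subgroup_kernel])
  obtain \<phi> where \<phi>: "\<phi> \<in> hom (VB n Mod ?D) ?T" "\<And>x. x \<in> carrier (VB n) \<Longrightarrow> \<phi> (?D #>\<^bsub>VB n\<^esub> x) = ?h x"
    using h.FactGroup_universal_kernel[OF derived_VP_normal D_kernel] by blast
  show thesis
  proof
    show "\<phi> \<in> hom (VB_mod_Gamma2_VP n) ?T" using \<phi>(1) by (simp add: VB_mod_Gamma2_VP_def)
  next
    fix x assume x: "x \<in> vb_gens n"
    then have w: "[(x, True)] \<in> words (vb_gens n)" by simp
    have "vb_gen_pair x \<in> carrier ?T" using vb_gen_pair_closed x by blast
    then show "\<phi> (vb_coset n [(x, True)]) = vb_gen_pair x"
      using \<phi>(2)[of "pres_class (vb_gens n) (vb_rels n) [(x, True)]"] h_class[OF w] w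
      by (simp add: vb_coset_def carrier_VB)
  next
    fix x y
    assume x: "x \<in> carrier (VB_mod_Gamma2_VP n)" "snd (\<phi> x) = id"
      and y: "y \<in> carrier (VB_mod_Gamma2_VP n)" "snd (\<phi> y) = id"
    obtain a where a: "a \<in> carrier (VB n)" "x = ?D #>\<^bsub>VB n\<^esub> a"
      using x by (auto simp: VB_mod_Gamma2_VP_def carrier_FactGroup)
    obtain b where b: "b \<in> carrier (VB n)" "y = ?D #>\<^bsub>VB n\<^esub> b"
      using y by (auto simp: VB_mod_Gamma2_VP_def carrier_FactGroup)
    have "a \<in> VP n" "b \<in> VP n" using a b x(2) y(2) \<phi>(2) VP_eq by simp_all
    then have "a \<otimes>\<^bsub>VB n\<^esub> b \<otimes>\<^bsub>VB n\<^esub> inv\<^bsub>VB n\<^esub> a \<otimes>\<^bsub>VB n\<^esub> inv\<^bsub>VB n\<^esub> b \<in> ?D"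
      unfolding derived_def by (blast intro: generate.incl)
    moreover have "a \<otimes>\<^bsub>VB n\<^esub> b = a \<otimes>\<^bsub>VB n\<^esub> b \<otimes>\<^bsub>VB n\<^esub> inv\<^bsub>VB n\<^esub> a \<otimes>\<^bsub>VB n\<^esub> inv\<^bsub>VB n\<^esub> b \<otimes>\<^bsub>VB n\<^esub> (b \<otimes>\<^bsub>VB n\<^esub> a)"
      using a b by (simp add: V.m_assoc V.inv_mult_cancel)
    ultimately have "a \<otimes>\<^bsub>VB n\<^esub> b \<in> ?D #>\<^bsub>VB n\<^esub> (b \<otimes>\<^bsub>VB n\<^esub> a)"
      by (auto simp: r_coset_def)
    then have "?D #>\<^bsub>VB n\<^esub> (b \<otimes>\<^bsub>VB n\<^esub> a) = ?D #>\<^bsub>VB n\<^esub> (a \<otimes>\<^bsub>VB n\<^esub> b)"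
      using V.repr_independence[OF _ _ D.subgroup_axioms] a b by simp
    then show "x \<otimes>\<^bsub>VB_mod_Gamma2_VP n\<^esub> y = y \<otimes>\<^bsub>VB_mod_Gamma2_VP n\<^esub> x"
      using a b D.rcos_sum by (simp add: VB_mod_Gamma2_VP_def)
  qed
qed

theorem VB_mod_Gamma2_VP_iso_pair_group:
  assumes n: "2 \<le> n"
  shows "VB_mod_Gamma2_VP n \<cong> pair_group n"
proof -
  let ?Q = "VB_mod_Gamma2_VP n"
  obtain \<phi> where \<phi>: "\<phi> \<in> hom ?Q (pair_group n)"
    "\<And>x. x \<in> vb_gens n \<Longrightarrow> \<phi> (vb_coset n [(x, True)]) = vb_gen_pair x"
    "\<And>x y. x \<in> carrier ?Q \<Longrightarrow> y \<in> carrier ?Q \<Longrightarrow> snd (\<phi> x) = id \<Longrightarrow> snd (\<phi> y) = id \<Longrightarrow>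
      x \<otimes>\<^bsub>?Q\<^esub> y = y \<otimes>\<^bsub>?Q\<^esub> x"
    using obtain_pair_hom by metis
  let ?r = "\<lambda>i. vb_coset n [rh i]" and ?s = "\<lambda>i. vb_coset n [sg i]"
  have gens: "Rho i \<in> vb_gens n" "Sig i \<in> vb_gens n" if "i \<in> {1..n-1}" for i
    using that by (auto simp: vb_gens_def)
  have w2: "vb_coset n [a, b] = vb_coset n [a] \<otimes>\<^bsub>?Q\<^esub> vb_coset n [b]"
    if "[a, b] \<in> words (vb_gens n)" for a b
    using vb_coset_append[of "[a]" "[b]"] that by simp
  have w3: "vb_coset n [a, b, c] = vb_coset n [a] \<otimes>\<^bsub>?Q\<^esub> vb_coset n [b] \<otimes>\<^bsub>?Q\<^esub> vb_coset n [c]"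
    if "[a, b, c] \<in> words (vb_gens n)" for a b c
    using vb_coset_append[of "[a, b]" "[c]"] w2[of a b] that by simp
  have rel2: "vb_coset n [a] \<otimes>\<^bsub>?Q\<^esub> vb_coset n [b] = vb_coset n [b] \<otimes>\<^bsub>?Q\<^esub> vb_coset n [a]"
    if "([a, b], [b, a]) \<in> vb_rels n" "[a, b] \<in> words (vb_gens n)" for a b
    using vb_coset_rel[OF that(1)] that(2) w2[of a b] w2[of b a] by simp
  have rel3: "vb_coset n [a] \<otimes>\<^bsub>?Q\<^esub> vb_coset n [b] \<otimes>\<^bsub>?Q\<^esub> vb_coset n [c]
      = vb_coset n [d] \<otimes>\<^bsub>?Q\<^esub> vb_coset n [e] \<otimes>\<^bsub>?Q\<^esub> vb_coset n [f]"
    if "([a, b, c], [d, e, f]) \<in> vb_rels n" "[a, b, c, d, e, f] \<in> words (vb_gens n)" for a b c d e f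
    using vb_coset_rel[OF that(1)] that(2) w3[of a b c] w3[of d e f] by simp
  have "virtual_braid_lift ?Q n ?r ?s \<phi>"
  proof (intro virtual_braid_lift.intro virtual_braid_lift_axioms.intro group_VB_mod_Gamma2_VP n \<phi>(1))
    fix i assume i: "i \<in> {1..n-1}"
    show "?r i \<in> carrier ?Q" "?s i \<in> carrier ?Q"
      using gens[OF i] by (simp_all add: carrier_quotient)
    show "?r i \<otimes>\<^bsub>?Q\<^esub> ?r i = \<one>\<^bsub>?Q\<^esub>"
    proof -
      have "([rh i, rh i], []) \<in> vb_rels n" using i by (auto simp: vb_rels_def)
      from vb_coset_rel[OF this] show ?thesis
        using gens[OF i] w2[of "rh i" "rh i"] by (simp add: vb_coset_Nil)
    qed
    show "\<phi> (?r i) = (0, transpose i (i+1))" "\<phi> (?s i) = (frag_of (i, i+1), transpose i (i+1))"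
      using \<phi>(2)[OF gens(1)[OF i]] \<phi>(2)[OF gens(2)[OF i]] by simp_all
  next
    fix i assume i: "i \<in> {1..n-2}"
    then have ii: "i \<in> {1..n-1}" "i + 1 \<in> {1..n-1}" by auto
    note g = gens[OF ii(1)] gens[OF ii(2)]
    have "([rh i, rh (i+1), rh i], [rh (i+1), rh i, rh (i+1)]) \<in> vb_rels n"
      "([rh i, rh (i+1), sg i], [sg (i+1), rh i, rh (i+1)]) \<in> vb_rels n"
      unfolding vb_rels_def using i by blast+
    from rel3[OF this(1)] rel3[OF this(2)] g
    show "?r i \<otimes>\<^bsub>?Q\<^esub> ?r (i+1) \<otimes>\<^bsub>?Q\<^esub> ?r i = ?r (i+1) \<otimes>\<^bsub>?Q\<^esub> ?r i \<otimes>\<^bsub>?Q\<^esub> ?r (i+1)"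
      "?r i \<otimes>\<^bsub>?Q\<^esub> ?r (i+1) \<otimes>\<^bsub>?Q\<^esub> ?s i = ?s (i+1) \<otimes>\<^bsub>?Q\<^esub> ?r i \<otimes>\<^bsub>?Q\<^esub> ?r (i+1)"
      by simp_all
  next
    fix i j assume ij: "i \<in> {1..n-1}" "j \<in> {1..n-1}" "\<bar>int i - int j\<bar> \<ge> 2"
    note g = gens[OF ij(1)] gens[OF ij(2)]
    have "([rh i, rh j], [rh j, rh i]) \<in> vb_rels n" "([sg i, rh j], [rh j, sg i]) \<in> vb_rels n"
      unfolding vb_rels_def using ij by blast+
    from rel2[OF this(1)] rel2[OF this(2)] g
    show "?r i \<otimes>\<^bsub>?Q\<^esub> ?r j = ?r j \<otimes>\<^bsub>?Q\<^esub> ?r i" "?s i \<otimes>\<^bsub>?Q\<^esub> ?r j = ?r j \<otimes>\<^bsub>?Q\<^esub> ?s i"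
      by simp_all
  next
    have "(\<lambda>x. vb_coset n [(x, True)]) ` vb_gens n = ?r ` {1..n-1} \<union> ?s ` {1..n-1}"
      unfolding vb_gens_def by blast
    then show "carrier ?Q = generate ?Q (?r ` {1..n-1} \<union> ?s ` {1..n-1})"
      using vb_coset_gens_generate by simp
  next
    fix x y assume "x \<in> carrier ?Q" "y \<in> carrier ?Q" "snd (\<phi> x) = id" "snd (\<phi> y) = id"
    then show "x \<otimes>\<^bsub>?Q\<^esub> y = y \<otimes>\<^bsub>?Q\<^esub> x" by (rule \<phi>(3))
  qed
  then show ?thesis unfolding is_iso_def using virtual_braid_lift.\<phi>_iso by blast
qed

end

section \<open>The Bieberbach subgroup\<close>

lemma n_cycle_apply:
  assumes n: "2 \<le> n" and i: "i \<in> {1..n}"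
  shows "n_cycle n i = (if i = 1 then n else i - 1)"
proof -
  let ?cs = "1 # rev [2..<n+1]"
  have rotate: "map (n_cycle n) ?cs = rotate1 ?cs"
    using cyclic_rotation[of ?cs 1] by (simp add: n_cycle_def)
  have nth: "rev [2..<n+1] ! k = n - k" if "k < n - 1" for k
    using that by (subst rev_nth) (auto simp del: upt_Suc)
  have val: "n_cycle n (?cs ! k) = (if k < n - 1 then n - k else 1)" if "k < n" for k
  proof -
    have "n_cycle n (?cs ! k) = map (n_cycle n) ?cs ! k"
      using that by (subst nth_map) auto
    also have "\<dots> = (rev [2..<n+1] @ [1]) ! k" unfolding rotate by simp
    also have "\<dots> = (if k < n - 1 then n - k else 1)"
      using that n nth by (auto simp: nth_append simp del: upt_Suc)
    finally show ?thesis .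
  qed
  show ?thesis
  proof (cases "i = 1")
    case True
    then show ?thesis using val[of 0] n by simp
  next
    case False
    then have k: "n + 1 - i = Suc (n - i)" "n - i < n - 1" "n + 1 - i < n" using i by auto
    then have "?cs ! (n + 1 - i) = i" using nth[OF k(2)] i by simp
    then show ?thesis using val[OF k(3)] False i by (auto split: if_splits)
  qed
qed

lemma n_cycle_permutes: "n \<ge> 2 \<Longrightarrow> n_cycle n permutes {1..n}"
proof -
  assume "n \<ge> 2"
  then have "set (1 # rev [2..<n+1]) = {1..n}" by auto
  then show ?thesis using cycle_permutes[of "1 # rev [2..<n+1]"] by (simp add: n_cycle_def)
qed

lemma funpow_n_cycle:
  assumes n: "2 \<le> n" and i: "i \<in> {1..n}"
  shows "(n_cycle n ^^ k) i \<in> {1..n}"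
    and "int ((n_cycle n ^^ k) i) = (int i - 1 - int k) mod int n + 1"
proof -
  show range: "(n_cycle n ^^ k) i \<in> {1..n}" for k
    using permutes_in_image[OF permutes_funpow[OF n_cycle_permutes[OF n]]] i by blast
  have step: "int (n_cycle n j) = (int j - 2) mod int n + 1" if "j \<in> {1..n}" for j
  proof (cases "j = 1")
    case True
    have "(-1) mod int n = int n - 1" using n by (simp add: zmod_minus1)
    then show ?thesis using True n_cycle_apply[OF n that] by simp
  next
    case False
    then show ?thesis using that n_cycle_apply[OF n that] by simp
  qed
  show "int ((n_cycle n ^^ k) i) = (int i - 1 - int k) mod int n + 1"
  proof (induction k)
    case 0
    then show ?case using i by simp
  next
    case (Suc k)
    have "int ((n_cycle n ^^ Suc k) i) = (int ((n_cycle n ^^ k) i) - 2) mod int n + 1"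
      using step[OF range[of k]] by simp
    also have "\<dots> = ((int i - 1 - int k) mod int n - 1) mod int n + 1"
      unfolding Suc.IH by simp
    also have "\<dots> = (int i - 1 - int (Suc k)) mod int n + 1"
      by (simp add: mod_diff_left_eq algebra_simps)
    finally show ?case .
  qed
qed

lemma sym_group_pow: "\<pi> [^]\<^bsub>sym_group n\<^esub> (k::nat) = \<pi> ^^ k"
proof (induction k)
  case (Suc k)
  have "\<pi> [^]\<^bsub>sym_group n\<^esub> Suc k = (\<pi> [^]\<^bsub>sym_group n\<^esub> k) \<circ> \<pi>"
    by (simp add: sym_group_def nat_pow_def)
  then show ?case unfolding Suc by (simp only: funpow_Suc_right)
qed (simp add: sym_group_def nat_pow_def)

lemma n_cycle_int_pow_eq_id:
  assumes n: "2 \<le> n"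
  shows "n_cycle n [^]\<^bsub>sym_group n\<^esub> (k::int) = id \<longleftrightarrow> int n dvd k"
proof -
  interpret S: group "sym_group n" by (rule sym_group_is_group)
  have c: "n_cycle n \<in> carrier (sym_group n)"
    using n_cycle_permutes[OF n] by (simp add: sym_group_def)
  have "n_cycle n ^^ k = id \<longleftrightarrow> n dvd k" for k
  proof
    assume "n_cycle n ^^ k = id"
    then have "1 = (1 - 1 - int k) mod int n + 1"
      using funpow_n_cycle(2)[OF n, of 1 k] n by simp
    then have "int n dvd - int k" by (simp add: dvd_eq_mod_eq_0)
    then show "n dvd k" by simp
  next
    assume dvd: "n dvd k"
    show "n_cycle n ^^ k = id"
    proof
      fix i
      show "(n_cycle n ^^ k) i = id i"
      proof (cases "i \<in> {1..n}")
        case True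
        have "(int i - 1 - int k) mod int n = (int i - 1) mod int n"
          using dvd by (auto simp: mod_eq_dvd_iff)
        then have "int ((n_cycle n ^^ k) i) = int i"
          using funpow_n_cycle(2)[OF n True] True by simp
        then show ?thesis by simp
      next
        case False
        then show ?thesis
          using permutes_not_in[OF permutes_funpow[OF n_cycle_permutes[OF n]]] by simp
      qed
    qed
  qed
  then have "S.ord (n_cycle n) = n"
    using S.ord_unique[OF c] by (simp add: sym_group_pow sym_group_one)
  then show ?thesis using S.int_pow_eq_id[OF c] by (simp add: sym_group_one)
qed

text \<open>Invariant under permutations of the coordinates, hence additive on all of \<open>pair_group n\<close>.\<close>

definition pair_sum :: "nat \<Rightarrow> (nat \<times> nat \<Rightarrow>\<^sub>0 int) \<Rightarrow> int"
  where "pair_sum n v = (\<Sum>ij\<in>pairs n. Poly_Mapping.lookup v ij)"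

lemma pair_sum_add: "pair_sum n (u + v) = pair_sum n u + pair_sum n v"
  by (simp add: pair_sum_def lookup_add sum.distrib)

lemma pair_sum_zero: "pair_sum n 0 = 0"
  by (simp add: pair_sum_def)

lemma pair_sum_minus: "pair_sum n (- v) = - pair_sum n v"
  by (simp add: pair_sum_def sum_negf)

lemma pair_sum_cmul: "pair_sum n (frag_cmul k v) = k * pair_sum n v"
  by (simp add: pair_sum_def sum_distrib_left)

lemma pair_sum_frag_of: "ij \<in> pairs n \<Longrightarrow> pair_sum n (frag_of ij) = 1"
  by (simp add: pair_sum_def finite_pairs sum.delta)

lemma pairs_image:
  assumes "\<pi> permutes {1..n}"
  shows "(\<pi> i, \<pi> j) \<in> pairs n \<longleftrightarrow> (i, j) \<in> pairs n"
  using permutes_in_image[OF assms] inj_eq[OF permutes_inj[OF assms]]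
  by (simp add: pairs_def del: atLeastAtMost_iff)

lemma pair_sum_pair_act:
  assumes "\<pi> permutes {1..n}"
  shows "pair_sum n (pair_act \<pi> v) = pair_sum n v"
  unfolding pair_sum_def
proof (rule sum.reindex_bij_witness[where i = "map_prod \<pi> \<pi>" and j = "map_prod (inv' \<pi>) (inv' \<pi>)"])
  fix a assume "a \<in> pairs n"
  then show "map_prod (inv' \<pi>) (inv' \<pi>) a \<in> pairs n"
    using pairs_image[OF permutes_inv[OF assms]] by (cases a) simp
next
  fix a assume "a \<in> pairs n"
  then show "map_prod \<pi> \<pi> a \<in> pairs n"
    using pairs_image[OF assms] by (cases a) simp
qed (use assms in \<open>auto simp: permutes_inverses map_prod_def lookup_pair_act permutes_bij split: prod.splits\<close>)

text \<open>The group that will be Bieberbach. The permutation is tied to the coordinate sum, so it cannot be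
  nontrivial unless the sum is nonzero; this is what excludes torsion. The pair formed by a basis
  vector and the \<open>n\<close>-cycle belongs to it and maps to a generator of the holonomy group.\<close>

definition twisted :: "nat \<Rightarrow> ((nat \<times> nat \<Rightarrow>\<^sub>0 int) \<times> (nat \<Rightarrow> nat)) set" where
  "twisted n = {(v, n_cycle n [^]\<^bsub>sym_group n\<^esub> pair_sum n v) | v. Poly_Mapping.keys v \<subseteq> pairs n}"

abbreviation twisted_group :: "nat \<Rightarrow> ((nat \<times> nat \<Rightarrow>\<^sub>0 int) \<times> (nat \<Rightarrow> nat)) monoid"
  where "twisted_group n \<equiv> (pair_group n)\<lparr>carrier := twisted n\<rparr>"

context
  fixes n :: nat
  assumes n: "2 \<le> n"
begin

interpretation S: group "sym_group n" by (rule sym_group_is_group)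
interpretation T: group "pair_group n" by (rule group_pair_group)

lemma n_cycle_closed: "n_cycle n \<in> carrier (sym_group n)"
  using n_cycle_permutes[OF n] by (simp add: sym_group_def)

lemma n_cycle_int_pow_permutes: "n_cycle n [^]\<^bsub>sym_group n\<^esub> (k::int) permutes {1..n}"
  using S.int_pow_closed[OF n_cycle_closed] by (simp add: sym_group_def)

lemma mem_twisted:
  "(v, \<pi>) \<in> twisted n \<longleftrightarrow>
    Poly_Mapping.keys v \<subseteq> pairs n \<and> \<pi> = n_cycle n [^]\<^bsub>sym_group n\<^esub> pair_sum n v"
  by (auto simp: twisted_def)

lemma subgroup_twisted: "subgroup (twisted n) (pair_group n)"
proof (rule T.subgroupI)
  show sub: "twisted n \<subseteq> carrier (pair_group n)"
    using n_cycle_int_pow_permutes by (auto simp: twisted_def carrier_pair_group)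
  have "(0, id) \<in> twisted n"
    by (simp add: mem_twisted pair_sum_zero sym_group_one)
  then show "twisted n \<noteq> {}" by blast
  show mult: "x \<otimes>\<^bsub>pair_group n\<^esub> y \<in> twisted n" if xy: "x \<in> twisted n" "y \<in> twisted n" for x y
  proof -
    let ?c = "\<lambda>v. n_cycle n [^]\<^bsub>sym_group n\<^esub> pair_sum n v"
    obtain u v where uv: "x = (u, ?c u)" "y = (v, ?c v)"
      "Poly_Mapping.keys u \<subseteq> pairs n" "Poly_Mapping.keys v \<subseteq> pairs n"
      using xy by (auto simp: twisted_def)
    have "x \<otimes>\<^bsub>pair_group n\<^esub> y \<in> carrier (pair_group n)" using xy sub by blast
    then have "Poly_Mapping.keys (u + pair_act (?c u) v) \<subseteq> pairs n"
      by (simp add: uv mult_pair_group carrier_pair_group)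
    moreover have "?c u \<circ> ?c v = ?c (u + pair_act (?c u) v)"
      using S.int_pow_mult[OF n_cycle_closed, of "pair_sum n u" "pair_sum n v"]
      by (simp add: pair_sum_add pair_sum_pair_act[OF n_cycle_int_pow_permutes] sym_group_mult)
    ultimately show ?thesis by (simp add: uv mult_pair_group mem_twisted)
  qed
  show "inv\<^bsub>pair_group n\<^esub> x \<in> twisted n" if x: "x \<in> twisted n" for x
  proof -
    have xc: "x \<in> carrier (pair_group n)" using x sub by blast
    let ?c = "\<lambda>v. n_cycle n [^]\<^bsub>sym_group n\<^esub> pair_sum n v"
    obtain u where u: "x = (u, ?c u)" "Poly_Mapping.keys u \<subseteq> pairs n"
      using x by (auto simp: twisted_def)
    let ?d = "n_cycle n [^]\<^bsub>sym_group n\<^esub> (- pair_sum n u)"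
    have d: "?d permutes {1..n}" by (rule n_cycle_int_pow_permutes)
    have "Poly_Mapping.keys (- pair_act ?d u) \<subseteq> pairs n"
      using keys_pair_act[OF d u(2)] by simp
    then have y: "(- pair_act ?d u, ?d) \<in> twisted n"
      by (simp add: mem_twisted pair_sum_minus pair_sum_pair_act[OF d])
    have "?d \<circ> ?c u = id"
      using S.int_pow_mult[OF n_cycle_closed, of "- pair_sum n u" "pair_sum n u"]
      by (simp add: sym_group_mult sym_group_one)
    then have "(- pair_act ?d u, ?d) \<otimes>\<^bsub>pair_group n\<^esub> x = \<one>\<^bsub>pair_group n\<^esub>"
      by (simp add: u(1) mult_pair_group one_pair_group)
    from T.inv_equality[OF this xc subsetD[OF sub y]] y show ?thesis
      by (simp only:)
  qed
qed

lemma group_twisted: "group (twisted_group n)"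
  using subgroup.subgroup_is_group[OF subgroup_twisted group_pair_group] .

lemma carrier_cyc_group: "carrier (cyc_group n) = range (\<lambda>k::int. n_cycle n [^]\<^bsub>sym_group n\<^esub> k)"
  using S.generate_pow[OF n_cycle_closed] by (auto simp: cyc_group_def)

lemma subgroup_cyc: "subgroup (carrier (cyc_group n)) (sym_group n)"
  using S.generate_is_subgroup[of "{n_cycle n}"] n_cycle_closed by (simp add: cyc_group_def)

lemma group_cyc_group: "group (cyc_group n)"
  using subgroup.subgroup_is_group[OF subgroup_cyc sym_group_is_group] by (simp add: cyc_group_def)

lemma finite_cyc_group: "finite (carrier (cyc_group n))"
proof (rule finite_subset)
  show "carrier (cyc_group n) \<subseteq> {\<pi>. \<pi> permutes {1..n}}"
    using subgroup.subset[OF subgroup_cyc] by (simp add: sym_group_def)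
qed (simp add: finite_permutations)

lemma frag_of_twisted:
  assumes "ij \<in> pairs n"
  shows "(frag_of ij, n_cycle n) \<in> twisted n"
  using assms by (simp add: mem_twisted pair_sum_frag_of S.int_pow_1[OF n_cycle_closed])

lemma snd_twisted_epi: "snd \<in> epi (twisted_group n) (cyc_group n)"
  unfolding epi_def
proof (intro CollectI conjI homI)
  fix x y assume "x \<in> carrier (twisted_group n)" "y \<in> carrier (twisted_group n)"
  then show "snd (x \<otimes>\<^bsub>twisted_group n\<^esub> y) = snd x \<otimes>\<^bsub>cyc_group n\<^esub> snd y"
    by (simp add: pair_group_def cyc_group_def sym_group_mult)
next
  fix x assume "x \<in> carrier (twisted_group n)"
  then show "snd x \<in> carrier (cyc_group n)"
    by (auto simp: twisted_def carrier_cyc_group)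
next
  show "snd ` carrier (twisted_group n) = carrier (cyc_group n)"
  proof
    show "carrier (cyc_group n) \<subseteq> snd ` carrier (twisted_group n)"
    proof
      fix \<pi> assume "\<pi> \<in> carrier (cyc_group n)"
      then obtain k :: int where k: "\<pi> = n_cycle n [^]\<^bsub>sym_group n\<^esub> k"
        by (auto simp: carrier_cyc_group)
      have p: "(1, 2) \<in> pairs n" using n by (simp add: pairs_def)
      have "pair_sum n (frag_cmul k (frag_of (1, 2))) = k"
        using p by (simp add: pair_sum_cmul pair_sum_frag_of)
      moreover have "Poly_Mapping.keys (frag_cmul k (frag_of (1, 2))) \<subseteq> pairs n"
        using p keys_cmul[of k "frag_of (1, 2)"] by auto
      ultimately have "(frag_cmul k (frag_of (1, 2)), \<pi>) \<in> twisted n"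
        by (simp add: mem_twisted k)
      then show "\<pi> \<in> snd ` carrier (twisted_group n)" by force
    qed
  qed (auto simp: twisted_def carrier_cyc_group)
qed

lemma kernel_twisted:
  "kernel (twisted_group n) (cyc_group n) snd
    = {(v, id) | v. Poly_Mapping.keys v \<subseteq> pairs n \<and> int n dvd pair_sum n v}"
  by (auto simp: kernel_def twisted_def cyc_group_def sym_group_one
      n_cycle_int_pow_eq_id[OF n] n_cycle_int_pow_eq_id[OF n, THEN iffD2, symmetric])

text \<open>If \<open>\<pi>\<close> fixes \<open>n e\<^sub>i\<^sub>j\<close>, a multiple of a basis vector that lies in the kernel, then \<open>\<pi> i = i\<close>.\<close>

lemma twisted_faithful:
  assumes g: "g \<in> twisted n"
    and comm: "\<And>x. x \<in> kernel (twisted_group n) (cyc_group n) snd \<Longrightarrow>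
      g \<otimes>\<^bsub>twisted_group n\<^esub> x = x \<otimes>\<^bsub>twisted_group n\<^esub> g"
  shows "snd g = id"
proof -
  obtain v \<pi> where v: "g = (v, \<pi>)" by force
  have \<pi>: "\<pi> permutes {1..n}"
    using g n_cycle_int_pow_permutes by (auto simp: v mem_twisted)
  have "\<pi> i = i" for i
  proof (cases "i \<in> {1..n}")
    case True
    define j where "j = (if i = 1 then 2 else 1 :: nat)"
    have ij: "(i, j) \<in> pairs n" using True n by (auto simp: pairs_def j_def)
    \<comment> \<open>The multiple \<open>n\<close> makes the coordinate sum divisible by \<open>n\<close>, which puts \<open>?u\<close> in the kernel.\<close>
    let ?u = "frag_cmul (int n) (frag_of (i, j))"
    have "(?u, id) \<in> kernel (twisted_group n) (cyc_group n) snd"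
      unfolding kernel_twisted using ij by (auto simp: pair_sum_cmul)
    from comm[OF this] have "pair_act \<pi> ?u = ?u"
      by (simp add: v mult_pair_group pair_act_id)
    then have "Poly_Mapping.lookup ?u (\<pi> i, \<pi> j) = Poly_Mapping.lookup ?u (i, j)"
      using lookup_pair_act_image[OF permutes_bij[OF \<pi>], of ?u i j] by simp
    then show ?thesis using n by (auto split: if_splits)
  next
    case False
    then show ?thesis using permutes_not_in[OF \<pi>] by blast
  qed
  then show ?thesis by (auto simp: v)
qed

lemma snd_id_imp_kernel:
  "g \<in> twisted n \<Longrightarrow> snd g = id \<Longrightarrow> g \<in> kernel (twisted_group n) (cyc_group n) snd"
  by (simp add: kernel_def cyc_group_def sym_group_one)

text \<open>The kernel is the sublattice of vectors with coordinate sum divisible by \<open>n\<close>. An explicit basis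
  of it comes from the map \<open>g\<close> that replaces the coordinate \<open>v\<^sub>1\<^sub>2\<close> by the one making the sum of all
  coordinates equal to \<open>n v\<^sub>1\<^sub>2\<close>.\<close>

lemma obtain_lattice_basis:
  obtains \<iota> where "\<iota> \<in> mon (free_Abelian_group {..<n * (n - 1)}) (twisted_group n)"
    "\<iota> ` carrier (free_Abelian_group {..<n * (n - 1)}) = kernel (twisted_group n) (cyc_group n) snd"
proof -
  let ?m = "n * (n - 1)" and ?F = "free_Abelian_group (pairs n)"
  have "{..<?m} \<approx> pairs n"
    unfolding eqpoll_def by (rule finite_same_card_bij) (simp_all add: finite_pairs card_pairs)
  then obtain e where e: "e \<in> iso (free_Abelian_group {..<?m}) ?F"
    using isomorphic_free_Abelian_groups[of "{..<?m}" "pairs n"] by (auto simp: is_iso_def)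
  have p0: "(1, 2) \<in> pairs n" using n by (simp add: pairs_def)
  let ?b = "frag_of (1, 2) :: nat \<times> nat \<Rightarrow>\<^sub>0 int"
  define g where "g v = v + frag_cmul (int n * Poly_Mapping.lookup v (1, 2) - pair_sum n v) ?b" for v
  have g_keys: "Poly_Mapping.keys (g v) \<subseteq> pairs n" if "Poly_Mapping.keys v \<subseteq> pairs n" for v
    using that keys_add[of v "frag_cmul (int n * Poly_Mapping.lookup v (1, 2) - pair_sum n v) ?b"]
      keys_cmul[of "int n * Poly_Mapping.lookup v (1, 2) - pair_sum n v" ?b] p0
    unfolding g_def by auto
  have g_sum: "pair_sum n (g v) = int n * Poly_Mapping.lookup v (1, 2)" for v
    using p0 by (simp add: g_def pair_sum_add pair_sum_cmul pair_sum_frag_of)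
  have g_other: "Poly_Mapping.lookup (g v) ij = Poly_Mapping.lookup v ij" if "ij \<noteq> (1, 2)" for v ij
    using that by (simp add: g_def lookup_add)
  have g_add: "g (u + v) = g u + g v" for u v
    by (simp add: g_def pair_sum_add lookup_add algebra_simps frag_cmul_distrib frag_cmul_diff_distrib)
  have g_zero: "v = 0" if "g v = 0" for v
  proof (rule poly_mapping_eqI)
    fix ij
    show "Poly_Mapping.lookup v ij = Poly_Mapping.lookup 0 ij"
    proof (cases "ij = (1, 2)")
      case True
      then show ?thesis using g_sum[of v] that n by (simp add: pair_sum_zero)
    next
      case False
      then show ?thesis using g_other[OF False, of v] that by simp
    qed
  qed
  have g_surj: "\<exists>v. Poly_Mapping.keys v \<subseteq> pairs n \<and> g v = u"
    if u: "Poly_Mapping.keys u \<subseteq> pairs n" "int n dvd pair_sum n u" for u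
  proof -
    obtain k where k: "pair_sum n u = int n * k" using u(2) by blast
    let ?a = "k - Poly_Mapping.lookup u (1, 2)"
    let ?v = "u + frag_cmul ?a ?b"
    have "Poly_Mapping.keys ?v \<subseteq> pairs n"
      using u keys_add[of u "frag_cmul ?a ?b"] keys_cmul[of ?a ?b] p0 by auto
    moreover have "g ?v = u"
    proof -
      have "int n * Poly_Mapping.lookup ?v (1, 2) - pair_sum n ?v = - ?a"
        using p0 by (simp add: lookup_add pair_sum_add pair_sum_cmul pair_sum_frag_of k)
      then have "g ?v = u + frag_cmul ?a ?b + frag_cmul (- ?a) ?b"
        by (simp only: g_def)
      also have "\<dots> = u" by (simp add: frag_cmul_distrib[symmetric] add.assoc)
      finally show ?thesis .
    qed
    ultimately show ?thesis by blast
  qed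
  let ?k = "\<lambda>v. (g v, id)"
  have k_in: "?k v \<in> kernel (twisted_group n) (cyc_group n) snd"
    if "Poly_Mapping.keys v \<subseteq> pairs n" for v
    unfolding kernel_twisted using g_keys[OF that] by (auto simp: g_sum)
  have "?k \<in> hom ?F (twisted_group n)"
  proof (rule homI)
    fix u v
    show "?k (u \<otimes>\<^bsub>?F\<^esub> v) = ?k u \<otimes>\<^bsub>twisted_group n\<^esub> ?k v"
      by (simp add: g_add mult_pair_group pair_act_id)
  qed (use k_in in \<open>auto simp: kernel_def\<close>)
  moreover have "v = \<one>\<^bsub>?F\<^esub>" if "?k v = \<one>\<^bsub>twisted_group n\<^esub>" for v
    using that g_zero by (simp add: one_pair_group)
  ultimately have k_mon: "?k \<in> mon ?F (twisted_group n)"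
    using group_twisted by (simp add: mon_iff_hom_one)
  have "?k \<circ> e \<in> mon (free_Abelian_group {..<?m}) (twisted_group n)"
    using e k_mon unfolding mon_def iso_def bij_betw_def
    by (auto intro: Group.hom_compose comp_inj_on)
  moreover have "(?k \<circ> e) ` carrier (free_Abelian_group {..<?m}) = kernel (twisted_group n) (cyc_group n) snd"
  proof -
    have "(?k \<circ> e) ` carrier (free_Abelian_group {..<?m}) = ?k ` carrier ?F"
      using e by (simp only: image_comp[symmetric] iso_def bij_betw_def mem_Collect_eq)
    also have "\<dots> = kernel (twisted_group n) (cyc_group n) snd"
    proof (intro equalityI subsetI)
      fix x assume "x \<in> kernel (twisted_group n) (cyc_group n) snd"
      then obtain u where u: "x = (u, id)" "Poly_Mapping.keys u \<subseteq> pairs n" "int n dvd pair_sum n u"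
        unfolding kernel_twisted by blast
      obtain v where "Poly_Mapping.keys v \<subseteq> pairs n" "g v = u" using g_surj[OF u(2,3)] by blast
      then show "x \<in> ?k ` carrier ?F" using u(1) by (intro image_eqI[of _ _ v]) simp_all
    qed (use k_in in auto)
    finally show ?thesis .
  qed
  ultimately show thesis by (rule that)
qed

lemma crystallographic_twisted:
  "crystallographic (twisted_group n) (n * (n - 1)) (cyc_group n)"
proof -
  obtain \<iota> where \<iota>: "\<iota> \<in> mon (free_Abelian_group {..<n * (n - 1)}) (twisted_group n)"
    "\<iota> ` carrier (free_Abelian_group {..<n * (n - 1)}) = kernel (twisted_group n) (cyc_group n) snd"
    using obtain_lattice_basis by metis
  show ?thesis
  proof (rule crystallographicI[OF group_twisted group_cyc_group finite_cyc_group \<iota>(1) snd_twisted_epi \<iota>(2)])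
    fix g assume g: "g \<in> carrier (twisted_group n)"
      and comm: "\<And>x. x \<in> kernel (twisted_group n) (cyc_group n) snd \<Longrightarrow>
        g \<otimes>\<^bsub>twisted_group n\<^esub> x = x \<otimes>\<^bsub>twisted_group n\<^esub> g"
    have "g \<in> twisted n" using g by simp
    then show "g \<in> kernel (twisted_group n) (cyc_group n) snd"
      using twisted_faithful[OF _ comm] snd_id_imp_kernel by blast
  qed
qed

text \<open>The coordinate sum is additive, so a torsion element has sum \<open>0\<close>. Its permutation is then the
  zeroth power of the cycle, and it lies in the lattice, which is torsion-free.\<close>

lemma torsion_free_twisted: "torsion_free (twisted_group n)"
  unfolding torsion_free_def
proof (intro ballI allI impI)
  fix x and k :: nat
  assume x: "x \<in> carrier (twisted_group n)" and k: "k > 0"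
    and "x [^]\<^bsub>twisted_group n\<^esub> k = \<one>\<^bsub>twisted_group n\<^esub>"
  then have pow: "x [^]\<^bsub>pair_group n\<^esub> k = (0, id)"
    using T.nat_pow_consistent[of x k "twisted n"] by (simp add: one_pair_group)
  have xT: "x \<in> carrier (pair_group n)"
    using x subgroup.mem_carrier[OF subgroup_twisted] by simp
  have deg: "pair_sum n (fst (x [^]\<^bsub>pair_group n\<^esub> j)) = int j * pair_sum n (fst x)" for j :: nat
  proof (induction j)
    case 0
    then show ?case by (simp add: one_pair_group pair_sum_zero)
  next
    case (Suc j)
    have "x [^]\<^bsub>pair_group n\<^esub> j \<in> carrier (pair_group n)" using xT by simp
    then have "snd (x [^]\<^bsub>pair_group n\<^esub> j) permutes {1..n}"
      by (metis carrier_pair_group prod.collapse)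
    then show ?case
      using Suc by (simp add: pair_group_def pair_sum_add pair_sum_pair_act algebra_simps)
  qed
  obtain v \<pi> where v: "x = (v, \<pi>)" by force
  have "pair_sum n v = 0" using deg[of k, unfolded pow] k by (simp add: pair_sum_zero v)
  then have \<pi>: "\<pi> = id" using x by (simp add: v mem_twisted sym_group_one)
  interpret \<iota>: group_hom "free_Abelian_group (pairs n)" "pair_group n" "\<lambda>v. (v, id)"
    using Pair_id_hom by (simp add: group_hom_def group_hom_axioms_def T.is_group)
  have "v \<in> carrier (free_Abelian_group (pairs n))" using x by (simp add: v mem_twisted)
  from \<iota>.hom_nat_pow[OF this, of k] have "(v, id) [^]\<^bsub>pair_group n\<^esub> k = (frag_cmul (int k) v, id)"
    by simp
  then have "frag_cmul (int k) v = 0" using pow[unfolded v \<pi>] by simp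
  then have "v = 0" using k by simp
  then show "x = \<one>\<^bsub>twisted_group n\<^esub>" by (simp add: v \<pi> one_pair_group)
qed

lemma bieberbach_twisted: "bieberbach (twisted_group n) (n * (n - 1)) (cyc_group n)"
  using crystallographic_twisted torsion_free_twisted by (simp add: bieberbach_def)

end

section \<open>The center\<close>

lemma pair_act_fixed_iff:
  assumes "bij \<pi>"
  shows "pair_act \<pi> v = v \<longleftrightarrow>
    (\<forall>i j. Poly_Mapping.lookup v (\<pi> i, \<pi> j) = Poly_Mapping.lookup v (i, j))"
proof
  assume "pair_act \<pi> v = v"
  then show "\<forall>i j. Poly_Mapping.lookup v (\<pi> i, \<pi> j) = Poly_Mapping.lookup v (i, j)"
    using lookup_pair_act_image[OF assms, of v] by metis
next
  assume *: "\<forall>i j. Poly_Mapping.lookup v (\<pi> i, \<pi> j) = Poly_Mapping.lookup v (i, j)"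
  show "pair_act \<pi> v = v"
  proof (rule poly_mapping_eqI)
    fix ij
    have "Poly_Mapping.lookup v (\<pi> (inv' \<pi> (fst ij)), \<pi> (inv' \<pi> (snd ij)))
        = Poly_Mapping.lookup v (inv' \<pi> (fst ij), inv' \<pi> (snd ij))"
      using * by blast
    then show "Poly_Mapping.lookup (pair_act \<pi> v) ij = Poly_Mapping.lookup v ij"
      by (simp add: lookup_pair_act[OF assms] surj_f_inv_f[OF bij_is_surj[OF assms]])
  qed
qed

text \<open>The invariant that separates the orbits of the \<open>n\<close>-cycle on pairs: the distance from the first
  entry to the second modulo \<open>n\<close>.\<close>

definition gap :: "nat \<Rightarrow> nat \<times> nat \<Rightarrow> nat"
  where "gap n ij = nat ((int (snd ij) - int (fst ij)) mod int n)"

text \<open>The lattice vector that is constant on the orbits; the coordinate \<open>d\<close> of \<open>u\<close> belongs to the orbit of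
  gap \<open>d + 1\<close>, since the gaps are \<open>1, \<dots>, n - 1\<close>.\<close>

definition spread :: "nat \<Rightarrow> (nat \<Rightarrow>\<^sub>0 int) \<Rightarrow> nat \<times> nat \<Rightarrow>\<^sub>0 int" where
  "spread n u = Abs_poly_mapping
    (\<lambda>ij. if ij \<in> pairs n then Poly_Mapping.lookup u (gap n ij - 1) else 0)"

lemma lookup_spread:
  "Poly_Mapping.lookup (spread n u) ij
    = (if ij \<in> pairs n then Poly_Mapping.lookup u (gap n ij - 1) else 0)"
proof -
  have "finite {ij. (if ij \<in> pairs n then Poly_Mapping.lookup u (gap n ij - 1) else 0) \<noteq> 0}"
    by (rule finite_subset[OF _ finite_pairs[of n]]) auto
  then show ?thesis by (simp add: spread_def Abs_poly_mapping_inverse)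
qed

lemma keys_spread: "Poly_Mapping.keys (spread n u) \<subseteq> pairs n"
  by (auto simp: in_keys_iff lookup_spread split: if_splits)

lemma spread_add: "spread n (u + v) = spread n u + spread n v"
  by (rule poly_mapping_eqI) (simp add: lookup_spread lookup_add)

lemma gap_range:
  assumes "2 \<le> n" "ij \<in> pairs n"
  shows "gap n ij \<in> {1..n-1}"
proof -
  obtain i j where ij: "ij = (i, j)" "i \<in> {1..n}" "j \<in> {1..n}" "i \<noteq> j"
    using assms(2) by (auto simp: pairs_def)
  have "(int j - int i) mod int n \<noteq> 0"
  proof
    assume "(int j - int i) mod int n = 0"
    then have "int n dvd int j - int i" by (simp add: dvd_eq_mod_eq_0)
    then have "int n \<le> \<bar>int j - int i\<bar>" using ij(4) dvd_imp_le_int[of "int j - int i" "int n"] by simp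
    then show False using ij by auto
  qed
  moreover have "0 \<le> (int j - int i) mod int n" "(int j - int i) mod int n < int n"
    using assms(1) by simp_all
  ultimately show ?thesis by (simp add: gap_def ij(1)) linarith
qed

lemma gap_first_row: "d < n - 1 \<Longrightarrow> gap n (1, d + 2) = d + 1"
  by (simp add: gap_def)

context
  fixes n :: nat
  assumes n: "2 \<le> n"
begin

lemma gap_n_cycle:
  assumes "i \<in> {1..n}" "j \<in> {1..n}"
  shows "gap n ((n_cycle n ^^ k) i, (n_cycle n ^^ k) j) = gap n (i, j)"
proof -
  have "(int ((n_cycle n ^^ k) j) - int ((n_cycle n ^^ k) i)) mod int n
      = ((int j - 1 - int k) mod int n - (int i - 1 - int k) mod int n) mod int n"
    using funpow_n_cycle(2)[OF n] assms by simp
  also have "\<dots> = (int j - int i) mod int n"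
    by (simp add: mod_diff_eq)
  finally show ?thesis by (simp add: gap_def)
qed

lemma spread_fixed: "pair_act (n_cycle n) (spread n u) = spread n u"
proof -
  have "Poly_Mapping.lookup (spread n u) (n_cycle n i, n_cycle n j)
      = Poly_Mapping.lookup (spread n u) (i, j)" for i j
    using pairs_image[OF n_cycle_permutes[OF n], of i j] gap_n_cycle[of i j 1]
    by (auto simp: lookup_spread pairs_def)
  then show ?thesis
    by (simp add: pair_act_fixed_iff permutes_bij[OF n_cycle_permutes[OF n]])
qed

lemma fixed_funpow:
  assumes "pair_act (n_cycle n) v = v"
  shows "Poly_Mapping.lookup v ((n_cycle n ^^ k) i, (n_cycle n ^^ k) j) = Poly_Mapping.lookup v (i, j)"
  using assms by (induction k) (simp_all add: pair_act_fixed_iff permutes_bij[OF n_cycle_permutes[OF n]])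

text \<open>The power of the cycle with exponent \<open>i - 1\<close> moves the pair \<open>(i, j)\<close> to the pair in the first row
  with the same gap, so an invariant vector is determined by its first row.\<close>

lemma fixed_imp_spread:
  assumes v: "Poly_Mapping.keys v \<subseteq> pairs n" "pair_act (n_cycle n) v = v"
  shows "\<exists>u. Poly_Mapping.keys u \<subseteq> {..<n-1} \<and> spread n u = v"
proof -
  define u where "u = Abs_poly_mapping (\<lambda>d. if d < n - 1 then Poly_Mapping.lookup v (1, d + 2) else 0)"
  have "finite {d. (if d < n - 1 then Poly_Mapping.lookup v (1, d + 2) else 0) \<noteq> 0}"
    by (rule finite_subset[of _ "{..<n-1}"]) auto
  then have u: "Poly_Mapping.lookup u d = (if d < n - 1 then Poly_Mapping.lookup v (1, d + 2) else 0)" for d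
    unfolding u_def by (simp add: Abs_poly_mapping_inverse)
  have "spread n u = v"
  proof (rule poly_mapping_eqI)
    fix ij
    show "Poly_Mapping.lookup (spread n u) ij = Poly_Mapping.lookup v ij"
    proof (cases "ij \<in> pairs n")
      case True
      obtain i j where ij: "ij = (i, j)" "i \<in> {1..n}" "j \<in> {1..n}"
        using True by (auto simp: pairs_def)
      have gap: "gap n ij \<in> {1..n-1}" using gap_range[OF n True] .
      let ?c = "n_cycle n ^^ (i - 1)"
      have "int (?c i) = 1" "int (?c j) = int (gap n ij) + 1"
        using funpow_n_cycle(2)[OF n, of i "i - 1"] funpow_n_cycle(2)[OF n, of j "i - 1"] ij n
        by (simp_all add: gap_def of_nat_diff)
      then have "?c i = 1" "?c j = gap n ij + 1" by linarith+
      moreover have "gap n ij - 1 < n - 1" "gap n ij - 1 + 2 = gap n ij + 1" using gap by auto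
      ultimately show ?thesis
        using fixed_funpow[OF v(2), of "i - 1" i j] True by (simp add: lookup_spread u ij(1))
    next
      case False
      then show ?thesis using v(1) by (auto simp: lookup_spread in_keys_iff)
    qed
  qed
  moreover have "Poly_Mapping.keys u \<subseteq> {..<n-1}"
    by (auto simp: in_keys_iff u split: if_splits)
  ultimately show ?thesis by blast
qed

lemma spread_eq_0:
  assumes "Poly_Mapping.keys u \<subseteq> {..<n-1}" "spread n u = 0"
  shows "u = 0"
proof (rule poly_mapping_eqI)
  fix d
  show "Poly_Mapping.lookup u d = Poly_Mapping.lookup 0 d"
  proof (cases "d < n - 1")
    case True
    then have "(1, d + 2) \<in> pairs n" by (auto simp: pairs_def)
    then have "Poly_Mapping.lookup u d = Poly_Mapping.lookup (spread n u) (1, d + 2)"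
      using gap_first_row[OF True] by (simp add: lookup_spread)
    then show ?thesis using assms(2) by simp
  next
    case False
    then show ?thesis using assms(1) by (auto simp: in_keys_iff)
  qed
qed

text \<open>The rows of an invariant vector are rearrangements of each other, so all \<open>n\<close> of them have the same
  sum. The diagonal may be added to each row because the vector vanishes there.\<close>

lemma dvd_pair_sum_fixed:
  assumes v: "Poly_Mapping.keys v \<subseteq> pairs n" "pair_act (n_cycle n) v = v"
  shows "int n dvd pair_sum n v"
proof -
  let ?row = "\<lambda>i. \<Sum>j\<in>{1..n}. Poly_Mapping.lookup v (i, j)"
  have "pair_sum n v = (\<Sum>ij\<in>{1..n} \<times> {1..n}. Poly_Mapping.lookup v ij)"
    unfolding pair_sum_def
    by (rule sum.mono_neutral_left) (use v(1) in \<open>auto simp: pairs_def in_keys_iff\<close>)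
  also have "\<dots> = (\<Sum>i\<in>{1..n}. ?row i)"
    by (simp add: sum.cartesian_product)
  also have "\<dots> = (\<Sum>i\<in>{1..n}. ?row 1)"
  proof (rule sum.cong[OF HOL.refl])
    fix i assume i: "i \<in> {1..n}"
    let ?c = "n_cycle n ^^ (i - 1)"
    have "int (?c i) = 1"
      using funpow_n_cycle(2)[OF n i, of "i - 1"] i n by (simp add: of_nat_diff)
    then have "?row 1 = (\<Sum>j\<in>{1..n}. Poly_Mapping.lookup v (?c i, j))" by simp
    also have "\<dots> = (\<Sum>j\<in>{1..n}. Poly_Mapping.lookup v (?c i, ?c j))"
      using sum.permute[OF permutes_funpow[OF n_cycle_permutes[OF n]], of "\<lambda>j. Poly_Mapping.lookup v (?c i, j)"]
      by (simp add: o_def)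
    also have "\<dots> = ?row i" by (simp only: fixed_funpow[OF v(2)])
    finally show "?row i = ?row 1" by simp
  qed
  also have "\<dots> = int n * ?row 1" by simp
  finally show ?thesis by simp
qed

lemma fixed_int_pow:
  assumes "pair_act (n_cycle n) v = v"
  shows "pair_act (n_cycle n [^]\<^bsub>sym_group n\<^esub> (k::int)) v = v"
proof -
  interpret S: group "sym_group n" by (rule sym_group_is_group)
  let ?c = "n_cycle n [^]\<^bsub>sym_group n\<^esub> nat (k mod int n)"
  have k: "k = int (nat (k mod int n)) + int n * (k div int n)" using n by simp
  have "n_cycle n [^]\<^bsub>sym_group n\<^esub> (int n * (k div int n)) = id"
    using n_cycle_int_pow_eq_id[OF n] by simp
  then have "n_cycle n [^]\<^bsub>sym_group n\<^esub> k = ?c"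
    using S.int_pow_mult[OF n_cycle_closed[OF n], of "int (nat (k mod int n))" "int n * (k div int n)"] k
    by (simp add: sym_group_mult int_pow_int)
  then have "n_cycle n [^]\<^bsub>sym_group n\<^esub> k = n_cycle n ^^ nat (k mod int n)"
    by (simp add: sym_group_pow)
  then show ?thesis
    using fixed_funpow[OF assms] permutes_bij[OF permutes_funpow[OF n_cycle_permutes[OF n]]]
    by (simp add: pair_act_fixed_iff)
qed

text \<open>A central element centralizes the kernel, so its permutation is trivial by faithfulness, and
  commuting with an element over the \<open>n\<close>-cycle makes its lattice part invariant. Conversely the
  coordinate sum of an invariant vector is divisible by \<open>n\<close>, so that the vector with the trivial
  permutation does belong to \<open>twisted n\<close>.\<close>

lemma center_twisted:
  "center (twisted_group n)
    = {(v, id) | v. Poly_Mapping.keys v \<subseteq> pairs n \<and> pair_act (n_cycle n) v = v}"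
proof (intro equalityI subsetI)
  fix x assume x: "x \<in> center (twisted_group n)"
  then have xt: "x \<in> twisted n" by (simp add: center_def)
  obtain v \<pi> where v: "x = (v, \<pi>)" by force
  have comm: "x \<otimes>\<^bsub>pair_group n\<^esub> y = y \<otimes>\<^bsub>pair_group n\<^esub> x" if "y \<in> twisted n" for y
    using x that by (simp add: center_def)
  have "snd x = id"
  proof (rule twisted_faithful[OF n xt])
    fix y assume "y \<in> kernel (twisted_group n) (cyc_group n) snd"
    then have "y \<in> twisted n" by (simp add: kernel_def)
    then show "x \<otimes>\<^bsub>twisted_group n\<^esub> y = y \<otimes>\<^bsub>twisted_group n\<^esub> x" using comm by simp
  qed
  moreover have p0: "(1, 2) \<in> pairs n" using n by (simp add: pairs_def)
  ultimately have "v + frag_of (1, 2) = frag_of (1, 2) + pair_act (n_cycle n) v"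
    using comm[OF frag_of_twisted[OF n p0]] by (simp add: v mult_pair_group pair_act_id)
  then have "pair_act (n_cycle n) v = v" by (simp add: add.commute)
  then show "x \<in> {(v, id) | v. Poly_Mapping.keys v \<subseteq> pairs n \<and> pair_act (n_cycle n) v = v}"
    using xt \<open>snd x = id\<close> by (simp add: v mem_twisted[OF n])
next
  fix x :: "(nat \<times> nat \<Rightarrow>\<^sub>0 int) \<times> (nat \<Rightarrow> nat)"
  assume "x \<in> {(v, id) | v. Poly_Mapping.keys v \<subseteq> pairs n \<and> pair_act (n_cycle n) v = v}"
  then obtain v where v: "x = (v, id)" "Poly_Mapping.keys v \<subseteq> pairs n" "pair_act (n_cycle n) v = v"
    by blast
  have "n_cycle n [^]\<^bsub>sym_group n\<^esub> pair_sum n v = id"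
    using dvd_pair_sum_fixed[OF v(2,3)] n_cycle_int_pow_eq_id[OF n] by simp
  then have "x \<in> twisted n" using v by (simp add: mem_twisted[OF n])
  moreover have "x \<otimes>\<^bsub>pair_group n\<^esub> y = y \<otimes>\<^bsub>pair_group n\<^esub> x" if "y \<in> twisted n" for y
  proof -
    obtain w where "y = (w, n_cycle n [^]\<^bsub>sym_group n\<^esub> pair_sum n w)"
      using \<open>y \<in> twisted n\<close> by (auto simp: twisted_def)
    then show ?thesis
      using fixed_int_pow[OF v(3)] by (simp add: v(1) mult_pair_group pair_act_id add.commute)
  qed
  ultimately show "x \<in> center (twisted_group n)" by (simp add: center_def)
qed

lemma center_twisted_iso:
  "(\<lambda>u. (spread n u, id)) \<in> iso (free_Abelian_group {..<n-1})
    ((pair_group n)\<lparr>carrier := center (twisted_group n)\<rparr>)"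
proof -
  let ?f = "\<lambda>u. (spread n u, id)" and ?Z = "(pair_group n)\<lparr>carrier := center (twisted_group n)\<rparr>"
  have "?f \<in> hom (free_Abelian_group {..<n-1}) ?Z"
    by (rule homI) (auto simp: center_twisted keys_spread spread_fixed spread_add mult_pair_group pair_act_id)
  moreover have "inj_on ?f (carrier (free_Abelian_group {..<n-1}))"
  proof (rule inj_onI)
    fix u v
    assume uv: "u \<in> carrier (free_Abelian_group {..<n-1})" "v \<in> carrier (free_Abelian_group {..<n-1})"
      "?f u = ?f v"
    have "spread n (u - v) + spread n v = spread n u" by (simp add: spread_add[symmetric])
    then have "spread n (u - v) = 0" using uv(3) by simp
    moreover have "Poly_Mapping.keys (u - v) \<subseteq> {..<n-1}"
      using uv keys_diff[of u v] by auto
    ultimately show "u = v" using spread_eq_0[of "u - v"] by simp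
  qed
  moreover have "?f ` carrier (free_Abelian_group {..<n-1}) = center (twisted_group n)"
  proof (intro equalityI subsetI)
    fix x assume "x \<in> center (twisted_group n)"
    then obtain v where v: "x = (v, id)" "Poly_Mapping.keys v \<subseteq> pairs n" "pair_act (n_cycle n) v = v"
      unfolding center_twisted by blast
    obtain u where "Poly_Mapping.keys u \<subseteq> {..<n-1}" "spread n u = v"
      using fixed_imp_spread[OF v(2,3)] by blast
    then show "x \<in> ?f ` carrier (free_Abelian_group {..<n-1})"
      using v(1) by (intro image_eqI[of _ _ u]) simp_all
  qed (auto simp: center_twisted keys_spread spread_fixed)
  ultimately show ?thesis by (simp add: iso_def bij_betw_def)
qed

end

section \<open>Bieberbach subgroups of the quotient\<close>

theorem theorem3p14:
  fixes n :: nat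
  assumes "n \<ge> 2"
  shows "\<exists>H. subgroup H (VB_mod_Gamma2_VP n)
    \<and> bieberbach ((VB_mod_Gamma2_VP n)\<lparr>carrier := H\<rparr>) (n * (n - 1)) (cyc_group n)
    \<and> (VB_mod_Gamma2_VP n)\<lparr>carrier := center ((VB_mod_Gamma2_VP n)\<lparr>carrier := H\<rparr>)\<rparr>
        \<cong> free_Abelian_group {..<n - 1}"
proof -
  let ?Q = "VB_mod_Gamma2_VP n" and ?T = "pair_group n"
  have "?T \<cong> ?Q"
    using group.iso_sym[OF group_VB_mod_Gamma2_VP VB_mod_Gamma2_VP_iso_pair_group[OF assms]] .
  then obtain \<psi> where \<psi>: "\<psi> \<in> iso ?T ?Q" by (auto simp: is_iso_def)
  interpret \<psi>: group_hom ?T ?Q \<psi>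
    using \<psi> by (simp add: group_hom_def group_hom_axioms_def iso_def group_pair_group
        group_VB_mod_Gamma2_VP)
  let ?H = "\<psi> ` twisted n"
  have H: "subgroup ?H ?Q"
    using \<psi>.subgroup_img_is_subgroup[OF subgroup_twisted[OF assms]] .
  have twisted: "twisted n \<subseteq> carrier ?T"
    using subgroup.subset[OF subgroup_twisted[OF assms]] .
  have \<psi>_H: "\<psi> \<in> iso (twisted_group n) (?Q\<lparr>carrier := ?H\<rparr>)"
    using iso_restrict_image[OF \<psi> twisted] .
  have "bieberbach (?Q\<lparr>carrier := ?H\<rparr>) (n * (n - 1)) (cyc_group n)"
    using bieberbach_iso[OF group_twisted[OF assms] _ \<psi>_H bieberbach_twisted[OF assms]]
      subgroup.subgroup_is_group[OF H group_VB_mod_Gamma2_VP] .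
  moreover have "?Q\<lparr>carrier := center (?Q\<lparr>carrier := ?H\<rparr>)\<rparr> \<cong> free_Abelian_group {..<n - 1}"
  proof -
    have "center (twisted_group n) \<subseteq> carrier ?T"
      using twisted by (auto simp: center_def)
    from iso_restrict_image[OF \<psi> this]
    have "\<psi> \<in> iso (?T\<lparr>carrier := center (twisted_group n)\<rparr>)
        (?Q\<lparr>carrier := center (?Q\<lparr>carrier := ?H\<rparr>)\<rparr>)"
      by (simp only: center_iso_image[OF group_twisted[OF assms] \<psi>_H])
    from iso_set_trans[OF center_twisted_iso[OF assms] this]
    have "free_Abelian_group {..<n - 1} \<cong> ?Q\<lparr>carrier := center (?Q\<lparr>carrier := ?H\<rparr>)\<rparr>"
      unfolding is_iso_def by blast
    then show ?thesis by (rule group.iso_sym[OF group_free_Abelian_group])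
  qed
  ultimately show ?thesis using H by blast
qed

end
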